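(* Let $0<\alpha<1$, $\gamma\ge0$ with $0<\alpha+\gamma\le1$. Let $(X_t,\ t\ge0)$ be the Cox-Ingersoll-Ross process, i.e. the diffusion on $(0,\infty)$ with infinitesimal mean and variance $$\mu(x)=-\theta\left(x-\frac{b}{a}\right),\qquad\sigma^2(x)=\frac{2\theta x}{a},$$ where $\theta>0$, $a>0$, $b>0$. Let $\boldsymbol{m}(x)=\frac{a^b}{\Gamma(b)}x^{b-1}e^{-ax}$, $x>0$, and let $(Q_n)_{n\ge0}$ be the orthonormal (Laguerre) polynomials with respect to $\boldsymbol{m}$. Let $(X^{(\alpha,\gamma)}_t,\ t\ge0)$ be the stretched non-local Cox-Ingersoll-Ross process with initial density $f$ (the density of $X^{(\alpha,\gamma)}_0$) such that $f/\boldsymbol{m}\in L_2(\boldsymbol{m}(x)dx)$ and $\sum_na_nQ_n$, with $a_n=\int_0^\infty f(y)Q_n(y)\,dy$, converges to $f/\boldsymbol{m}$ uniformly on finite intervals contained in $(0,\infty)$. Then the density $p_{\alpha,\gamma}(t,x)$ of $X^{(\alpha,\gamma)}_t$ satisfies $$p_{\alpha,\gamma}(t,x)\to\frac{a^b}{\Gamma(b)}x^{b-1}\exp(-ax),\qquad\text{as }t\to\infty .$$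
   Context: The convergence is pointwise in $x\in(0,\infty)$. The CIR process is the Markov process on $(0,\infty)$ with transition density $\boldsymbol{m}(x)\sum_{n\ge0}e^{-\lambda_nt}Q_n(x)Q_n(y)$, $\lambda_n=\theta n$. The stretched non-local process is $X^{(\alpha,\gamma)}_t:=X_{t^{\alpha+\gamma}Z}$, where $Z=\int_0^\infty(1-\sigma^\alpha_s)_+^\gamma\,ds$ is independent of $(X_t)$ and $(\sigma^\alpha_s,s\ge0)$ is the $\alpha$-stable subordinator with $\mathbb{E}e^{-\lambda\sigma^\alpha_s}=e^{-s\lambda^\alpha}$ (with $(u)_+^\gamma=u^\gamma$ for $u>0$, $0$ for $u\le 0$). The density of $X^{(\alpha,\gamma)}_t$, $t>0$, is taken to be $p_{\alpha,\gamma}(t,x)=\int\boldsymbol{p}_{\alpha,\gamma}(x,t;y)f(y)\,dy$, where $$\boldsymbol{p}_{\alpha,\gamma}(x,t;y)=\boldsymbol{m}(x)\sum_{n=0}^\infty\operatorname{E}_{\alpha,1+\gamma/\alpha,\gamma/\alpha}(-\lambda_nt^{\alpha+\gamma})Q_n(x)Q_n(y)$$ is the transition density of $X^{(\alpha,\gamma)}$; here the Kilbas-Saigo function is $\operatorname{E}_{a,m,l}(z)=\sum_{n\ge0}c_nz^n$, $c_0=1$, $c_n=\prod_{k=0}^{n-1}\frac{\Gamma[1+a(km+l)]}{\Gamma[1+a(km+l+1)]}$. The generator of $X$ is $\mu(x)\frac{d}{dx}+\frac{\sigma^2(x)}{2}\frac{d^2}{dx^2}$, and $Q_n$ has degree $n$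 and is its eigenfunction with eigenvalue $-\lambda_n$. *)

theory Defs
  imports "HOL-Probability.Probability"
begin

section \<open>Stationary density and orthonormal polynomials\<close>

definition gamma_dens :: "real \<Rightarrow> real \<Rightarrow> real \<Rightarrow> real" where
  "gamma_dens a b x = a powr b / Gamma b * x powr (b - 1) * exp (- a * x)"

text \<open>Orthonormality on the half-line determines each polynomial up to its sign; every
  expression below is invariant under changing the sign of some of them.\<close>

definition orthonormal_polys :: "(real \<Rightarrow> real) \<Rightarrow> (nat \<Rightarrow> real poly) \<Rightarrow> bool" where
  "orthonormal_polys w Q \<longleftrightarrow>
     (\<forall>n. degree (Q n) = n) \<and>
     (\<forall>i j. set_integrable lborel {0<..} (\<lambda>x. poly (Q i) x * poly (Q j) x * w x)) \<and>
     (\<forall>i j. (LBINT x:{0<..}. poly (Q i) x * poly (Q j) x * w x) = (if i = j then 1 else 0))"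

section \<open>Diffusions on the positive half-line\<close>

text \<open>Transition densities are written \<open>p x t y\<close>: the density at \<open>x\<close>, after time \<open>t\<close>,
  of the process started at \<open>y\<close>.\<close>

definition has_infinitesimal_mean ::
  "(real \<Rightarrow> real \<Rightarrow> real \<Rightarrow> real) \<Rightarrow> (real \<Rightarrow> real) \<Rightarrow> bool" where
  "has_infinitesimal_mean p \<mu> \<longleftrightarrow>
     (\<forall>y>0. ((\<lambda>h. (LBINT x:{0<..}. (x - y) * p x h y) / h) \<longlongrightarrow> \<mu> y) (at_right 0))"

definition has_infinitesimal_variance ::
  "(real \<Rightarrow> real \<Rightarrow> real \<Rightarrow> real) \<Rightarrow> (real \<Rightarrow> real) \<Rightarrow> bool" where
  "has_infinitesimal_variance p v \<longleftrightarrow>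
     (\<forall>y>0. ((\<lambda>h. (LBINT x:{0<..}. (x - y)\<^sup>2 * p x h y) / h) \<longlongrightarrow> v y) (at_right 0))"

definition past_algebra :: "'w measure \<Rightarrow> (real \<Rightarrow> 'w \<Rightarrow> real) \<Rightarrow> real \<Rightarrow> 'w measure" where
  "past_algebra M X s =
     vimage_algebra (space M) (\<lambda>\<omega>. \<lambda>r\<in>{0..s}. X r \<omega>) (PiM {0..s} (\<lambda>_. borel))"

text \<open>Positivity is required almost surely at each fixed time, not along whole paths: for
  \<open>b < 1\<close> the paths of the Cox-Ingersoll-Ross process touch \<open>0\<close> at exceptional times, while
  its one-dimensional distributions live on the open half-line.\<close>

definition half_line_diffusion ::
  "'w measure \<Rightarrow> (real \<Rightarrow> real \<Rightarrow> real \<Rightarrow> real) \<Rightarrow> (real \<Rightarrow> real) \<Rightarrow> (real \<Rightarrow> real)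
     \<Rightarrow> (real \<Rightarrow> 'w \<Rightarrow> real) \<Rightarrow> bool" where
  "half_line_diffusion M p \<mu> v X \<longleftrightarrow>
     has_infinitesimal_mean p \<mu> \<and>
     has_infinitesimal_variance p v \<and>
     (\<forall>t\<ge>0. X t \<in> borel_measurable M) \<and>
     (\<forall>t\<ge>0. AE \<omega> in M. X t \<omega> > 0) \<and>
     (\<forall>\<omega>\<in>space M. continuous_on {0..} (\<lambda>t. X t \<omega>)) \<and>
     (\<forall>s\<ge>0. \<forall>t>0. \<forall>A\<in>sets borel.
        AE \<omega> in M. real_cond_exp M (past_algebra M X s) (\<lambda>\<omega>'. indicator A (X (s + t) \<omega>')) \<omega>
          = (LBINT x:A \<inter> {0<..}. p x t (X s \<omega>)))"

definition cir_eigenvalue :: "real \<Rightarrow> nat \<Rightarrow> real" where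
  "cir_eigenvalue \<theta> n = \<theta> * real n"

definition cir_transition_density ::
  "real \<Rightarrow> real \<Rightarrow> real \<Rightarrow> (nat \<Rightarrow> real poly) \<Rightarrow> real \<Rightarrow> real \<Rightarrow> real \<Rightarrow> real" where
  "cir_transition_density \<theta> a b Q x t y =
     gamma_dens a b x *
       (\<Sum>n. exp (- cir_eigenvalue \<theta> n * t) * poly (Q n) x * poly (Q n) y)"

definition cir_process ::
  "'w measure \<Rightarrow> real \<Rightarrow> real \<Rightarrow> real \<Rightarrow> (nat \<Rightarrow> real poly) \<Rightarrow> (real \<Rightarrow> 'w \<Rightarrow> real) \<Rightarrow> bool" where
  "cir_process M \<theta> a b Q X \<longleftrightarrow>
     half_line_diffusion M (cir_transition_density \<theta> a b Q)
       (\<lambda>x. - \<theta> * (x - b / a)) (\<lambda>x. 2 * \<theta> * x / a) X"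

section \<open>The random time change\<close>

definition stable_subordinator ::
  "'w measure \<Rightarrow> real \<Rightarrow> (real \<Rightarrow> 'w \<Rightarrow> real) \<Rightarrow> bool" where
  "stable_subordinator M \<alpha> S \<longleftrightarrow>
     (\<forall>s\<ge>0. S s \<in> borel_measurable M) \<and>
     (\<forall>\<omega>\<in>space M. S 0 \<omega> = 0 \<and> mono_on {0..} (\<lambda>s. S s \<omega>) \<and>
        (\<forall>s\<ge>0. continuous (at_right s) (\<lambda>r. S r \<omega>))) \<and>
     (\<forall>(t :: nat \<Rightarrow> real) n. 0 \<le> t 0 \<and> (\<forall>i<n. t i \<le> t (Suc i)) \<longrightarrow>
        prob_space.indep_vars M (\<lambda>_. borel) (\<lambda>i \<omega>. S (t (Suc i)) \<omega> - S (t i) \<omega>) {..<n}) \<and>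
     (\<forall>r\<ge>0. \<forall>s\<ge>0. distr M borel (\<lambda>\<omega>. S (r + s) \<omega> - S r \<omega>) = distr M borel (S s)) \<and>
     (\<forall>s\<ge>0. \<forall>u\<ge>0. (\<integral>\<omega>. exp (- u * S s \<omega>) \<partial>M) = exp (- s * u powr \<alpha>))"

definition pos_part_powr :: "real \<Rightarrow> real \<Rightarrow> real" where
  "pos_part_powr u \<gamma> = (if u > 0 then u powr \<gamma> else 0)"

definition time_functional :: "real \<Rightarrow> (real \<Rightarrow> 'w \<Rightarrow> real) \<Rightarrow> 'w \<Rightarrow> real" where
  "time_functional \<gamma> S \<omega> = (LBINT s:{0..}. pos_part_powr (1 - S s \<omega>) \<gamma>)"

definition stretched_process ::
  "real \<Rightarrow> real \<Rightarrow> (real \<Rightarrow> 'w \<Rightarrow> real) \<Rightarrow> ('w \<Rightarrow> real) \<Rightarrow> real \<Rightarrow> 'w \<Rightarrow> real" where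
  "stretched_process \<alpha> \<gamma> X Z t \<omega> = X (t powr (\<alpha> + \<gamma>) * Z \<omega>) \<omega>"

text \<open>\<open>Y\<close> is the stretched non-local process built from the Cox-Ingersoll-Ross process \<open>X\<close>,
  and \<open>f\<close> is the density of \<open>Y 0 = X 0\<close> on the positive half-line.  Only
  the functional \<open>time_functional \<gamma> S\<close>, not the whole subordinator, is required to be
  independent of \<open>X\<close>, which enters as a random element of the product space over all times.\<close>

definition stretched_cir_process ::
  "'w measure \<Rightarrow> real \<Rightarrow> real \<Rightarrow> real \<Rightarrow> real \<Rightarrow> real \<Rightarrow> (nat \<Rightarrow> real poly) \<Rightarrow> (real \<Rightarrow> real)
     \<Rightarrow> (real \<Rightarrow> 'w \<Rightarrow> real) \<Rightarrow> (real \<Rightarrow> 'w \<Rightarrow> real) \<Rightarrow> (real \<Rightarrow> 'w \<Rightarrow> real) \<Rightarrow> bool" where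
  "stretched_cir_process M \<alpha> \<gamma> \<theta> a b Q f X S Y \<longleftrightarrow>
     prob_space M \<and>
     cir_process M \<theta> a b Q X \<and>
     stable_subordinator M \<alpha> S \<and>
     prob_space.indep_set M
       (sets (vimage_algebra (space M) (\<lambda>\<omega>. \<lambda>t\<in>{0..}. X t \<omega>) (PiM {0..} (\<lambda>_. borel))))
       (sets (vimage_algebra (space M) (time_functional \<gamma> S) borel)) \<and>
     Y = stretched_process \<alpha> \<gamma> X (time_functional \<gamma> S) \<and>
     (\<forall>x>0. f x \<ge> 0) \<and>
     distributed M lborel (Y 0) (\<lambda>x. ennreal (indicator {0<..} x * f x))"

section \<open>The density of the stretched process\<close>

definition kilbas_saigo_coeff :: "real \<Rightarrow> real \<Rightarrow> real \<Rightarrow> nat \<Rightarrow> real" where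
  "kilbas_saigo_coeff a m l n =
     (\<Prod>k<n. Gamma (1 + a * (real k * m + l)) / Gamma (1 + a * (real k * m + l + 1)))"

definition kilbas_saigo :: "real \<Rightarrow> real \<Rightarrow> real \<Rightarrow> real \<Rightarrow> real" where
  "kilbas_saigo a m l z = (\<Sum>n. kilbas_saigo_coeff a m l n * z ^ n)"

text \<open>A density is only determined almost everywhere; pointwise statements refer to the version
  given by the spectral expansion below, for \<open>t > 0\<close> and \<open>x > 0\<close>.\<close>

definition stretched_cir_transition_density ::
  "real \<Rightarrow> real \<Rightarrow> real \<Rightarrow> real \<Rightarrow> real \<Rightarrow> (nat \<Rightarrow> real poly) \<Rightarrow> real \<Rightarrow> real \<Rightarrow> real \<Rightarrow> real" where
  "stretched_cir_transition_density \<alpha> \<gamma> \<theta> a b Q x t y =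
     gamma_dens a b x *
       (\<Sum>n. kilbas_saigo \<alpha> (1 + \<gamma> / \<alpha>) (\<gamma> / \<alpha>) (- cir_eigenvalue \<theta> n * t powr (\<alpha> + \<gamma>))
             * poly (Q n) x * poly (Q n) y)"

definition stretched_cir_density ::
  "real \<Rightarrow> real \<Rightarrow> real \<Rightarrow> real \<Rightarrow> real \<Rightarrow> (nat \<Rightarrow> real poly) \<Rightarrow> (real \<Rightarrow> real)
     \<Rightarrow> real \<Rightarrow> real \<Rightarrow> real" where
  "stretched_cir_density \<alpha> \<gamma> \<theta> a b Q f t x =
     (LBINT y:{0<..}. stretched_cir_transition_density \<alpha> \<gamma> \<theta> a b Q x t y * f y)"

end

theory Submission
  imports Defs
begin

text \<open>The density is \<open>m(x) \<Sum>\<^sub>n E(-\<lambda>\<^sub>n t\<^sup>\<beta>) Q\<^sub>n(x) a\<^sub>n\<close> with \<open>\<beta> = \<alpha> + \<gamma>\<close>, where \<open>E\<close> is the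
  Kilbas-Saigo function. Its term with \<open>n = 0\<close> is \<open>m(x)\<close>, and the remainder is of order
  \<open>t powr (-\<beta>)\<close> because \<open>0 \<le> E(-w) \<le> C / w\<close>, \<open>\<Sum>\<^sub>n Q\<^sub>n(x)\<^sup>2 / n < \<infinity>\<close> and
  \<open>\<Sum>\<^sub>n a\<^sub>n\<^sup>2 < \<infinity>\<close>.

  The bounds on \<open>E\<close> come from the fact that \<open>y(u) = E(-z u\<^sup>\<beta>)\<close> solves the fractional equation
  \<open>D\<^sup>\<alpha> y = -z u\<^sup>\<gamma> y\<close> in the sense of Caputo: a maximum principle shows that \<open>y\<close> is nonnegative and
  decreasing in \<open>z\<close>, and integrating the equation over \<open>(0, 1)\<close> then gives \<open>z y(1) \<le> C\<close>.
  The second series is controlled by Bessel's inequality, once for \<open>Q\<^sub>n\<close> and once for the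
  derivatives \<open>Q\<^sub>n'\<close>, which are orthogonal for the weight \<open>x m(x)\<close> with squared norm \<open>a n\<close>.\<close>

section \<open>The Kilbas-Saigo function on the negative half-line\<close>

text \<open>Nonnegativity turns gauge integrability into Lebesgue integrability. This brings the
  Beta and Gamma integrals, available as gauge integrals, into the Bochner setting.\<close>

lemma has_bochner_integral_of_has_integral:
  fixes f :: "real \<Rightarrow> real"
  assumes f: "(f has_integral I) A" and A: "A \<in> sets borel" and meas: "f \<in> borel_measurable borel"
    and nn: "\<And>x. x \<in> A \<Longrightarrow> 0 \<le> f x"
  shows "has_bochner_integral lborel (\<lambda>x. indicator A x * f x) I"
proof -
  let ?g = "\<lambda>x. indicator A x * f x"
  have "(?g has_integral I) UNIV"
  proof -
    have "?g = (\<lambda>x. if x \<in> A then f x else 0)" by (auto simp: indicator_def)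
    with f show ?thesis by (simp only: has_integral_restrict_UNIV)
  qed
  moreover have nng: "0 \<le> ?g x" for x using nn by (auto simp: indicator_def)
  moreover have m: "?g \<in> borel_measurable borel" using A meas by measurable
  ultimately have "(\<integral>\<^sup>+x. ennreal (indicator UNIV x * ?g x) \<partial>lborel) = ennreal I"
    by (intro nn_integral_has_integral_lborel) auto
  moreover have "0 \<le> I" using f nn by (rule has_integral_nonneg)
  ultimately show ?thesis using m nng by (intro has_bochner_integral_nn_integral) auto
qed

text \<open>The substitution \<open>u = x * t\<close> reduces this to the Beta integral. It
  evaluates the singular kernel of the Caputo derivative against each power occurring in the
  series.\<close>

lemma has_bochner_integral_beta_scaled:
  fixes p \<alpha> x :: real
  assumes "-1 < p" "\<alpha> < 1" "0 < x"
  shows "has_bochner_integral lborel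
           (\<lambda>u. indicator {0<..<x} u * ((x - u) powr (- \<alpha>) * u powr p))
           (x powr (p + 1 - \<alpha>) * Beta (p + 1) (1 - \<alpha>))"
proof -
  have "((\<lambda>t. t powr p * (1 - t) powr (-\<alpha>)) has_integral Beta (p+1) (1-\<alpha>)) {0<..<1}"
    using has_integral_Beta_real[of "p+1" "1-\<alpha>"] assms by (simp add: has_integral_Icc_iff_Ioo)
  then have "has_bochner_integral lborel
      (\<lambda>t. indicator {0<..<1} t * (t powr p * (1 - t) powr (-\<alpha>))) (Beta (p+1) (1-\<alpha>))"
    by (intro has_bochner_integral_of_has_integral) auto
  then have B: "has_bochner_integral lborel (\<lambda>t. x powr (p-\<alpha>) *
      (indicator {0<..<1} t * (t powr p * (1 - t) powr (-\<alpha>)))) (x powr (p-\<alpha>) * Beta (p+1) (1-\<alpha>))"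
    by (rule has_bochner_integral_mult_right)
  have eq: "x powr (p-\<alpha>) * (indicator {0<..<1} t * (t powr p * (1 - t) powr (-\<alpha>)))
        = indicator {0<..<x} (0 + x * t) * ((x - (0 + x * t)) powr (- \<alpha>) * (0 + x * t) powr p)" for t
  proof (cases "0 < t \<and> t < 1")
    case True
    have "x - x * t = x * (1 - t)" by (simp add: algebra_simps)
    then have "(x - x * t) powr (-\<alpha>) = x powr (-\<alpha>) * (1 - t) powr (-\<alpha>)"
      using True assms by (simp only: powr_mult)
    moreover have "(x * t) powr p = x powr p * t powr p" using True assms by (simp add: powr_mult)
    moreover have "x powr (p - \<alpha>) = x powr p * x powr (-\<alpha>)" by (simp flip: powr_add)
    ultimately show ?thesis using True assms by (simp add: indicator_def)
  next
    case False
    then have "\<not> (0 < x * t \<and> x * t < x)" using assms by (auto simp: zero_less_mult_iff)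
    with False show ?thesis by (auto simp: indicator_def)
  qed
  have "x powr (p-\<alpha>) * Beta (p+1) (1-\<alpha>) = (x powr (p + 1 - \<alpha>) * Beta (p + 1) (1 - \<alpha>)) /\<^sub>R \<bar>x\<bar>"
    using assms by (simp add: powr_add powr_diff field_simps)
  with B show ?thesis
    unfolding eq using assms
    by (subst lborel_has_bochner_integral_real_affine_iff[where c = x and t = 0]) auto
qed

lemma has_bochner_integral_powr:
  fixes p x :: real
  assumes "-1 < p" "0 < x"
  shows "has_bochner_integral lborel (\<lambda>u. indicator {0<..<x} u * u powr p) (x powr (p + 1) / (p + 1))"
proof -
  have "((\<lambda>u. u powr p) has_integral (x powr (p + 1) / (p + 1))) {0<..<x}"
    using has_integral_powr_from_0[of p x] assms by (simp add: has_integral_Icc_iff_Ioo)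
  then show ?thesis by (intro has_bochner_integral_of_has_integral) auto
qed

lemma has_bochner_integral_kernel:
  fixes \<alpha> x :: real
  assumes "\<alpha> < 1" "0 < x"
  shows "has_bochner_integral lborel (\<lambda>u. indicator {0<..<x} u * (x - u) powr (- \<alpha>)) (x powr (1 - \<alpha>) / (1 - \<alpha>))"
proof -
  have "Beta 1 (1 - \<alpha>) = 1 / (1 - \<alpha>)"
  proof -
    have "Gamma (1 + (1 - \<alpha>)) = (1 - \<alpha>) * Gamma (1 - \<alpha>)"
      using assms Gamma_plus1[of "1 - \<alpha>"] by (auto simp: add.commute nonpos_Ints_def)
    moreover have "Gamma (1 - \<alpha>) \<noteq> 0" using Gamma_real_pos[of "1 - \<alpha>"] assms by linarith
    ultimately show ?thesis unfolding Beta_def by (simp only: Gamma_1) (use assms in simp)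
  qed
  moreover have "has_bochner_integral lborel
           (\<lambda>u. indicator {0<..<x} u * ((x - u) powr (- \<alpha>) * u powr 0)) (x powr (0+1 - \<alpha>) * Beta (0+1) (1 - \<alpha>))"
    by (rule has_bochner_integral_beta_scaled) (use assms in auto)
  moreover have "(\<lambda>u. indicator {0<..<x} u * ((x - u) powr (- \<alpha>) * u powr 0)) = (\<lambda>u. indicator {0<..<x} u * (x - u) powr (- \<alpha>))"
    by (auto simp: indicator_def)
  ultimately show ?thesis by simp
qed

text \<open>Log-convexity of Gamma: \<open>x + 1\<close> is the convex combination of
  \<open>x + \<alpha>\<close> and \<open>x + \<alpha> + 1\<close> with weights
  \<open>\<alpha>\<close> and \<open>1 - \<alpha>\<close>. The functional equation then rewrites
  Gamma at \<open>x + 1\<close> and at \<open>x + \<alpha> + 1\<close>.\<close>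

lemma Gamma_ratio_le_Wendel:
  fixes x \<alpha> :: real
  assumes "0 < \<alpha>" "\<alpha> < 1" "0 < x"
  shows "Gamma x / Gamma (x + \<alpha>) \<le> (x + \<alpha>) powr (1 - \<alpha>) / x"
proof -
  have "(ln \<circ> Gamma) ((1 - (1-\<alpha>)) *\<^sub>R (x + \<alpha>) + (1-\<alpha>) *\<^sub>R (x + \<alpha> + 1))
       \<le> (1 - (1-\<alpha>)) * (ln \<circ> Gamma) (x + \<alpha>) + (1-\<alpha>) * (ln \<circ> Gamma) (x + \<alpha> + 1)"
    by (rule convex_onD[OF log_convex_Gamma_real]) (use assms in auto)
  moreover have "(1 - (1-\<alpha>)) *\<^sub>R (x + \<alpha>) + (1-\<alpha>) *\<^sub>R (x + \<alpha> + 1) = x + 1" by (simp add: algebra_simps)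
  moreover have g: "Gamma (x + 1) = x * Gamma x" "Gamma (x + \<alpha> + 1) = (x + \<alpha>) * Gamma (x + \<alpha>)"
    using assms by (auto intro!: Gamma_plus1 simp: nonpos_Ints_def)
  moreover have p: "Gamma x > 0" "Gamma (x + \<alpha>) > 0" using assms by auto
  ultimately have "ln (x * Gamma x) \<le> \<alpha> * ln (Gamma (x + \<alpha>)) + (1 - \<alpha>) * ln ((x + \<alpha>) * Gamma (x + \<alpha>))"
    by simp
  also have "\<dots> = ln (Gamma (x + \<alpha>) * (x + \<alpha>) powr (1 - \<alpha>))"
  proof -
    have "ln ((x + \<alpha>) * Gamma (x + \<alpha>)) = ln (x + \<alpha>) + ln (Gamma (x + \<alpha>))"
         "ln (Gamma (x + \<alpha>) * (x + \<alpha>) powr (1 - \<alpha>)) = ln (Gamma (x + \<alpha>)) + (1 - \<alpha>) * ln (x + \<alpha>)"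
      using p assms by (simp_all add: ln_mult_pos ln_powr)
    then show ?thesis by (simp only:) (simp add: algebra_simps)
  qed
  finally have "x * Gamma x \<le> Gamma (x + \<alpha>) * (x + \<alpha>) powr (1 - \<alpha>)"
    using p assms by (subst (asm) ln_le_cancel_iff) auto
  then show ?thesis using p assms by (simp add: field_simps)
qed

text \<open>The upper bound is of order \<open>x powr (-\<alpha>)\<close>. Along the series this
  quotient is the ratio of consecutive coefficients, so the radius of convergence will be
  infinite.\<close>

lemma Gamma_ratio_tendsto_0:
  fixes \<alpha> :: real
  assumes "0 < \<alpha>" "\<alpha> < 1"
  shows "((\<lambda>x. Gamma x / Gamma (x + \<alpha>)) \<longlongrightarrow> 0) at_top"
proof (rule tendsto_sandwich[OF _ _ tendsto_const])
  show "((\<lambda>x. (x + \<alpha>) powr (1 - \<alpha>) / x) \<longlongrightarrow> 0) at_top" using assms by real_asymp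
  show "eventually (\<lambda>x. Gamma x / Gamma (x + \<alpha>) \<le> (x + \<alpha>) powr (1 - \<alpha>) / x) at_top"
    using eventually_gt_at_top[of 0] by eventually_elim (use assms Gamma_ratio_le_Wendel in auto)
  show "eventually (\<lambda>x. 0 \<le> Gamma x / Gamma (x + \<alpha>)) at_top"
    using eventually_gt_at_top[of 0] by eventually_elim (use assms in \<open>auto intro!: divide_nonneg_nonneg simp: less_imp_le\<close>)
qed

section \<open>The Kilbas-Saigo series and its fractional equation\<close>

lemma kilbas_saigo_coeff_Suc:
  assumes "0 < \<alpha>"
  shows "kilbas_saigo_coeff \<alpha> (1 + \<gamma>/\<alpha>) (\<gamma>/\<alpha>) (Suc n) = kilbas_saigo_coeff \<alpha> (1 + \<gamma>/\<alpha>) (\<gamma>/\<alpha>) n *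
     (Gamma (real n * (\<alpha> + \<gamma>) + \<gamma> + 1) / Gamma (real n * (\<alpha> + \<gamma>) + \<gamma> + 1 + \<alpha>))"
proof -
  have "1 + \<alpha> * (real n * (1 + \<gamma>/\<alpha>) + \<gamma>/\<alpha>) = real n * (\<alpha> + \<gamma>) + \<gamma> + 1"
       "1 + \<alpha> * (real n * (1 + \<gamma>/\<alpha>) + \<gamma>/\<alpha> + 1) = real n * (\<alpha> + \<gamma>) + \<gamma> + 1 + \<alpha>"
    using assms by (simp_all add: field_simps)
  then show ?thesis by (simp only: kilbas_saigo_coeff_def prod.lessThan_Suc)
qed

lemma kilbas_saigo_coeff_nonneg:
  assumes "0 < \<alpha>" "0 \<le> \<gamma>"
  shows "0 \<le> kilbas_saigo_coeff \<alpha> (1 + \<gamma>/\<alpha>) (\<gamma>/\<alpha>) n"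
proof (induction n)
  case 0
  then show ?case by (simp add: kilbas_saigo_coeff_def)
next
  case (Suc n)
  have "0 < real n * (\<alpha> + \<gamma>) + \<gamma> + 1" using assms by (simp add: add_nonneg_pos)
  with Suc assms show ?case unfolding kilbas_saigo_coeff_Suc[OF assms(1)]
    by (intro mult_nonneg_nonneg divide_nonneg_nonneg) (auto intro!: less_imp_le[OF Gamma_real_pos])
qed

lemma summable_kilbas_saigo:
  assumes "0 < \<alpha>" "\<alpha> < 1" "0 \<le> \<gamma>"
  shows "summable (\<lambda>n. kilbas_saigo_coeff \<alpha> (1 + \<gamma>/\<alpha>) (\<gamma>/\<alpha>) n * w ^ n)"
proof -
  let ?c = "kilbas_saigo_coeff \<alpha> (1 + \<gamma>/\<alpha>) (\<gamma>/\<alpha>)"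
  let ?r = "\<lambda>n. Gamma (real n * (\<alpha> + \<gamma>) + \<gamma> + 1) / Gamma (real n * (\<alpha> + \<gamma>) + \<gamma> + 1 + \<alpha>)"
  have "filterlim (\<lambda>n::nat. real n * (\<alpha> + \<gamma>) + \<gamma> + 1) at_top sequentially"
    using assms by real_asymp
  from filterlim_compose[OF Gamma_ratio_tendsto_0 this] assms
  have "?r \<longlonglongrightarrow> 0" by simp
  then have "(\<lambda>n. \<bar>?r n * w\<bar>) \<longlonglongrightarrow> 0" using tendsto_mult_left_zero tendsto_rabs_zero by blast
  then have "eventually (\<lambda>n. \<bar>?r n * w\<bar> < 1/2) sequentially" by (rule order_tendstoD) simp
  then obtain N where N: "\<And>n. n \<ge> N \<Longrightarrow> \<bar>?r n * w\<bar> < 1/2" by (auto simp: eventually_sequentially)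
  show ?thesis
  proof (rule summable_ratio_test[of "1/2" N])
    fix n assume "n \<ge> N"
    have "norm (?c (Suc n) * w ^ Suc n) = \<bar>?r n * w\<bar> * norm (?c n * w ^ n)"
      unfolding kilbas_saigo_coeff_Suc[OF assms(1)] by (simp add: abs_mult)
    also have "\<dots> \<le> 1/2 * norm (?c n * w ^ n)"
      using N[OF \<open>n \<ge> N\<close>] by (intro mult_right_mono) auto
    finally show "norm (?c (Suc n) * w ^ Suc n) \<le> 1/2 * norm (?c n * w ^ n)" .
  qed simp
qed

text \<open>The third claim is the Caputo equation
  \<open>D\<^sup>\<alpha> g = - z u\<^sup>\<gamma> g\<close> integrated over \<open>(0, x)\<close>.
  It is proved by termwise integration: the coefficient recursion is exactly what makes term
  \<open>n + 1\<close> on the left agree with term \<open>n\<close> on the right.\<close>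

lemma kilbas_saigo_fractional_integral:
  fixes z :: real
  assumes al: "0 < \<alpha>" "\<alpha> < 1" and ga: "0 \<le> \<gamma>" and x: "0 < x"
  defines "g \<equiv> \<lambda>u. kilbas_saigo \<alpha> (1 + \<gamma>/\<alpha>) (\<gamma>/\<alpha>) (- z * u powr (\<alpha> + \<gamma>))"
  shows "integrable lborel (\<lambda>u. indicator {0<..<x} u * ((x - u) powr (-\<alpha>) * (g u - 1)))"
    and "integrable lborel (\<lambda>u. indicator {0<..<x} u * (u powr \<gamma> * g u))"
    and "(\<integral>u. indicator {0<..<x} u * ((x - u) powr (-\<alpha>) * (g u - 1)) \<partial>lborel)
       = - z * Gamma (1 - \<alpha>) * (\<integral>u. indicator {0<..<x} u * (u powr \<gamma> * g u) \<partial>lborel)"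
proof -
  define c where "c = kilbas_saigo_coeff \<alpha> (1 + \<gamma>/\<alpha>) (\<gamma>/\<alpha>)"
  define \<beta> where "\<beta> = \<alpha> + \<gamma>"
  \<comment> \<open>\<open>A n\<close> is the power of \<open>x\<close> that both sides produce: the
    kernel integral of \<open>u powr ((n + 1) * \<beta>)\<close> and the plain integral of
    \<open>u powr (n * \<beta> + \<gamma>)\<close>. Their values are \<open>I n\<close> and
    \<open>J n\<close>.\<close>
  define A where "A n = real n * \<beta> + \<gamma> + 1" for n
  define t where "t n u = indicator {0<..<x} u * ((x - u) powr (-\<alpha>) * u powr (real (Suc n) * \<beta>))" for n u
  define r where "r n u = indicator {0<..<x} u * u powr (real n * \<beta> + \<gamma>)" for n u
  define I where "I n = x powr A n * Beta (A n + \<alpha>) (1 - \<alpha>)" for n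
  define J where "J n = x powr A n / A n" for n
  have c0: "c n \<ge> 0" for n unfolding c_def by (rule kilbas_saigo_coeff_nonneg) (use al ga x in auto)
  have sm: "summable (\<lambda>n. c n * w ^ n)" for w unfolding c_def by (rule summable_kilbas_saigo) (use al ga x in auto)
  have sma: "summable (\<lambda>n. \<bar>c n * w ^ n\<bar>)" for w
    using sm[of "\<bar>w\<bar>"] c0 by (simp add: abs_mult power_abs)
  have A1: "A n \<ge> 1" for n using al ga by (simp add: A_def \<beta>_def)
  have t: "has_bochner_integral lborel (t n) (I n)" for n
  proof -
    have "-1 < real (Suc n) * \<beta>" using mult_nonneg_nonneg[of "real (Suc n)" \<beta>] al ga unfolding \<beta>_def by linarith
    then have "has_bochner_integral lborel (t n)
        (x powr (real (Suc n) * \<beta> + 1 - \<alpha>) * Beta (real (Suc n) * \<beta> + 1) (1 - \<alpha>))"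
      unfolding t_def by (rule has_bochner_integral_beta_scaled) (use al ga x in auto)
    moreover have "real (Suc n) * \<beta> + 1 - \<alpha> = A n" "real (Suc n) * \<beta> + 1 = A n + \<alpha>"
      by (simp_all add: A_def \<beta>_def algebra_simps)
    ultimately show ?thesis by (simp only: I_def)
  qed
  have r: "has_bochner_integral lborel (r n) (J n)" for n
  proof -
    have "-1 < real n * \<beta> + \<gamma>" using mult_nonneg_nonneg[of "real n" \<beta>] al ga unfolding \<beta>_def by linarith
    from has_bochner_integral_powr[OF this x] show ?thesis unfolding r_def J_def A_def .
  qed
  \<comment> \<open>The Beta value in \<open>I n\<close> carries the reciprocal of the Gamma
    quotient by which \<open>c (Suc n)\<close> differs from \<open>c n\<close>. What survives is
    \<open>Gamma (1 - \<alpha>) / A n\<close>, and the denominator belongs to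
    \<open>J n\<close>.\<close>
  have cI: "c (Suc n) * I n = Gamma (1 - \<alpha>) * (c n * J n)" for n
  proof -
    have "Gamma (A n + \<alpha>) \<noteq> 0" "Gamma (A n) \<noteq> 0"
      using Gamma_real_pos[of "A n + \<alpha>"] Gamma_real_pos[of "A n"] A1[of n] al by linarith+
    moreover have "Gamma (A n + \<alpha> + (1 - \<alpha>)) = A n * Gamma (A n)"
      using Gamma_plus1[of "A n"] A1[of n] by (auto simp: nonpos_Ints_def)
    moreover have "c (Suc n) = c n * (Gamma (A n) / Gamma (A n + \<alpha>))"
      unfolding c_def A_def \<beta>_def by (rule kilbas_saigo_coeff_Suc) fact
    ultimately show ?thesis using A1[of n] unfolding I_def J_def Beta_def by (simp only:) (simp add: divide_simps)
  qed
  have t0: "0 \<le> t n u" and r0: "0 \<le> r n u" for n u by (simp_all add: t_def r_def)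
  \<comment> \<open>Since \<open>A n \<ge> 1\<close>, the division in \<open>J n\<close> may be
    dropped. The majorant is the absolutely convergent series at the argument
    \<open>z * x powr \<beta>\<close>.\<close>
  have smJ: "summable (\<lambda>n. \<bar>c n * (- z) ^ n\<bar> * J n)"
  proof (rule summable_comparison_test[OF _ summable_mult[OF sma[of "z * x powr \<beta>"], of "x powr (\<gamma> + 1)"]], intro exI allI impI)
    fix n
    have "J n \<le> x powr A n" using A1[of n] x by (simp add: J_def field_simps)
    also have "\<dots> = x powr (\<gamma> + 1) * (x powr \<beta>) ^ n"
      using x by (simp add: A_def powr_add powr_power mult.commute)
    finally have "\<bar>c n * (- z) ^ n\<bar> * J n \<le> \<bar>c n * (- z) ^ n\<bar> * (x powr (\<gamma> + 1) * (x powr \<beta>) ^ n)"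
      by (rule mult_left_mono) simp
    also have "\<dots> = x powr (\<gamma> + 1) * \<bar>c n * (z * x powr \<beta>) ^ n\<bar>"
      by (simp add: abs_mult power_mult_distrib power_abs)
    finally show "norm (\<bar>c n * (- z) ^ n\<bar> * J n) \<le> x powr (\<gamma> + 1) * \<bar>c n * (z * x powr \<beta>) ^ n\<bar>"
      using A1[of n] by (simp add: J_def)
  qed
  define K where "K n = c (Suc n) * (-z) ^ Suc n" for n
  define L where "L n = c n * (-z) ^ n" for n
  have KI: "K n * I n = - z * Gamma (1 - \<alpha>) * (L n * J n)" for n
  proof -
    have "K n * I n = (c (Suc n) * I n) * (-z) ^ Suc n" by (simp add: K_def)
    also have "\<dots> = - z * Gamma (1 - \<alpha>) * (L n * J n)" unfolding cI by (simp add: L_def)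
    finally show ?thesis .
  qed
  have J0: "J n \<ge> 0" for n
    using A1[of n] by (simp add: J_def)
  have I0: "I n \<ge> 0" for n
    using Bochner_Integration.integral_nonneg[of lborel "t n", OF t0] unfolding has_bochner_integral_integral_eq[OF t] .
  have smI: "summable (\<lambda>n. \<bar>K n\<bar> * I n)"
  proof -
    have "\<bar>K n\<bar> * I n = \<bar>z * Gamma (1 - \<alpha>)\<bar> * (\<bar>L n\<bar> * J n)" for n
    proof -
      have "\<bar>K n\<bar> * I n = \<bar>K n * I n\<bar>" using I0[of n] by (simp add: abs_mult)
      also have "\<dots> = \<bar>z * Gamma (1 - \<alpha>)\<bar> * (\<bar>L n\<bar> * J n)" unfolding KI using J0[of n] by (simp add: abs_mult)
      finally show ?thesis .
    qed
    then show ?thesis using summable_mult[OF smJ] by (simp only: L_def)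
  qed
  have pw: "(u powr \<beta>) ^ n = u powr (real n * \<beta>)" if "0 < u" for u n
    using that by (simp add: powr_power mult.commute)
  have gs: "(\<lambda>n. L n * u powr (real n * \<beta>)) sums g u" if "0 < u" for u
  proof -
    have "(\<lambda>n. c n * (- z * u powr \<beta>) ^ n) sums g u"
      using sm unfolding g_def kilbas_saigo_def c_def \<beta>_def by (rule summable_sums)
    moreover have "c n * (- z * u powr \<beta>) ^ n = L n * u powr (real n * \<beta>)" for n
      using pw[OF that, of n] unfolding L_def by (simp only: power_mult_distrib mult.assoc)
    ultimately show ?thesis by simp
  qed
  have gsa: "summable (\<lambda>n. \<bar>L n\<bar> * u powr (real n * \<beta>))" if "0 < u" for u
  proof -
    have "\<bar>c n * (- z * u powr \<beta>) ^ n\<bar> = \<bar>L n\<bar> * u powr (real n * \<beta>)" for n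
      using pw[OF that, of n] unfolding L_def by (simp only: power_mult_distrib abs_mult mult.assoc) simp
    with sma[of "- z * u powr \<beta>"] show ?thesis by (simp only:)
  qed
  have L0: "L 0 = 1" by (simp add: L_def c_def kilbas_saigo_coeff_def)
  have LS: "L (Suc n) = K n" for n by (simp add: L_def K_def)
  \<comment> \<open>Subtracting 1 from \<open>g\<close> removes the term \<open>L 0 = 1\<close>;
    hence the shifted coefficients \<open>K n = L (Suc n)\<close>.\<close>
  have Ts: "(\<lambda>n. K n * t n u) sums (indicator {0<..<x} u * ((x - u) powr (-\<alpha>) * (g u - 1)))" for u
  proof (cases "u \<in> {0<..<x}")
    case True
    then have "(\<lambda>n. L (Suc n) * u powr (real (Suc n) * \<beta>)) sums (g u - 1)"
      using gs[of u] L0 by (subst sums_Suc_iff) simp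
    from sums_mult[OF this, of "(x - u) powr (-\<alpha>)"] show ?thesis using True by (simp add: t_def LS mult_ac)
  qed (simp add: t_def)
  have Rs: "(\<lambda>n. L n * r n u) sums (indicator {0<..<x} u * (u powr \<gamma> * g u))" for u
  proof (cases "u \<in> {0<..<x}")
    case True
    with sums_mult[OF gs[of u], of "u powr \<gamma>"] show ?thesis by (simp add: r_def powr_add mult_ac)
  qed (simp add: r_def)
  have Tsa: "summable (\<lambda>n. norm (K n * t n u))" for u
  proof (cases "u \<in> {0<..<x}")
    case True
    then have "summable (\<lambda>n. \<bar>L (Suc n)\<bar> * u powr (real (Suc n) * \<beta>))"
      using gsa[of u] by (subst summable_Suc_iff) simp
    from summable_mult[OF this, of "(x - u) powr (-\<alpha>)"] show ?thesis using True by (simp add: t_def LS abs_mult mult_ac)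
  qed (simp add: t_def)
  have Rsa: "summable (\<lambda>n. norm (L n * r n u))" for u
  proof (cases "u \<in> {0<..<x}")
    case True
    with summable_mult[OF gsa[of u], of "u powr \<gamma>"] show ?thesis by (simp add: r_def powr_add abs_mult mult_ac)
  qed (simp add: r_def)
  have hT: "has_bochner_integral lborel (\<lambda>u. K n * t n u) (K n * I n)"
    and hTn: "has_bochner_integral lborel (\<lambda>u. norm (K n * t n u)) (\<bar>K n\<bar> * I n)" for n
    using has_bochner_integral_mult_right[OF t, of "K n" n] has_bochner_integral_mult_right[OF t, of "\<bar>K n\<bar>" n] t0
    by (simp_all add: abs_mult)
  have hR: "has_bochner_integral lborel (\<lambda>u. L n * r n u) (L n * J n)"
    and hRn: "has_bochner_integral lborel (\<lambda>u. norm (L n * r n u)) (\<bar>L n\<bar> * J n)" for n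
    using has_bochner_integral_mult_right[OF r, of "L n" n] has_bochner_integral_mult_right[OF r, of "\<bar>L n\<bar>" n] r0
    by (simp_all add: abs_mult)
  have eqT: "(\<lambda>u. \<Sum>n. K n * t n u) = (\<lambda>u. indicator {0<..<x} u * ((x - u) powr (-\<alpha>) * (g u - 1)))"
    and eqR: "(\<lambda>u. \<Sum>n. L n * r n u) = (\<lambda>u. indicator {0<..<x} u * (u powr \<gamma> * g u))"
    using sums_unique[OF Ts] sums_unique[OF Rs] by (simp_all only:)
  have smT: "summable (\<lambda>n. \<integral>u. norm (K n * t n u) \<partial>lborel)"
    unfolding has_bochner_integral_integral_eq[OF hTn] by (rule smI)
  have smR: "summable (\<lambda>n. \<integral>u. norm (L n * r n u) \<partial>lborel)"
    unfolding has_bochner_integral_integral_eq[OF hRn] using smJ by (simp add: L_def)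
  note T = integrable.intros[OF hT] AE_I2[OF Tsa] smT
  note R = integrable.intros[OF hR] AE_I2[OF Rsa] smR
  show "integrable lborel (\<lambda>u. indicator {0<..<x} u * ((x - u) powr (-\<alpha>) * (g u - 1)))"
    using integrable_suminf[OF T] unfolding eqT .
  show "integrable lborel (\<lambda>u. indicator {0<..<x} u * (u powr \<gamma> * g u))"
    using integrable_suminf[OF R] unfolding eqR .
  have "(\<lambda>n. K n * I n) sums (\<integral>u. indicator {0<..<x} u * ((x - u) powr (-\<alpha>) * (g u - 1)) \<partial>lborel)"
    using sums_integral[OF T] unfolding eqT has_bochner_integral_integral_eq[OF hT] .
  moreover have "(\<lambda>n. L n * J n) sums (\<integral>u. indicator {0<..<x} u * (u powr \<gamma> * g u) \<partial>lborel)"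
    using sums_integral[OF R] unfolding eqR has_bochner_integral_integral_eq[OF hR] .
  ultimately show "(\<integral>u. indicator {0<..<x} u * ((x - u) powr (-\<alpha>) * (g u - 1)) \<partial>lborel)
       = - z * Gamma (1 - \<alpha>) * (\<integral>u. indicator {0<..<x} u * (u powr \<gamma> * g u) \<partial>lborel)"
    unfolding KI using sums_mult sums_unique2 by blast
qed

text \<open>The maximum principle for the Caputo derivative, in integrated form. At a negative minimum
  \<open>x0\<close> of \<open>v\<close>, comparing the identity at \<open>x0\<close> and \<open>x0 - e\<close> bounds \<open>e h(x0) / 2\<close> by a
  multiple of \<open>e powr (2 - \<alpha>)\<close>, which fails for small \<open>e\<close>.\<close>
lemma fractional_maximum_principle:
  fixes v h :: "real \<Rightarrow> real"
  assumes al: "0 < \<alpha>" "\<alpha> < 1"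
    and cv: "continuous_on {0..} v" and dv: "\<And>x. 0 < x \<Longrightarrow> v differentiable (at x)"
    and ch: "\<And>x. 0 < x \<Longrightarrow> isCont h x"
    and vi: "\<And>x. 0 < x \<Longrightarrow> integrable lborel (\<lambda>u. indicator {0<..<x} u * ((x - u) powr (-\<alpha>) * (v u - v 0)))"
    and hi: "\<And>x. 0 < x \<Longrightarrow> integrable lborel (\<lambda>u. indicator {0<..<x} u * h u)"
    and eq: "\<And>x. 0 < x \<Longrightarrow> (\<integral>u. indicator {0<..<x} u * ((x - u) powr (-\<alpha>) * (v u - v 0)) \<partial>lborel)
        = (\<integral>u. indicator {0<..<x} u * h u \<partial>lborel)"
    and pos: "\<And>x. 0 < x \<Longrightarrow> v x < 0 \<Longrightarrow> 0 < h x"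
    and v0: "0 \<le> v 0" and x1: "0 \<le> x1"
  shows "0 \<le> v x1"
proof (rule ccontr)
  assume "\<not> 0 \<le> v x1"
  then have neg: "v x1 < 0" by simp
  have "continuous_on {0..x1} v" using cv by (rule continuous_on_subset) auto
  then obtain x0 where x0: "x0 \<in> {0..x1}" and min: "\<And>u. u \<in> {0..x1} \<Longrightarrow> v x0 \<le> v u"
    using continuous_attains_inf[of "{0..x1}" v] x1 by auto
  define m where "m = v x0"
  have m: "m < 0" using min[of x1] x1 neg by (simp add: m_def)
  have x0p: "0 < x0" using x0 m v0 by (cases "x0 = 0") (auto simp: m_def)
  have h0: "0 < h x0" using pos[OF x0p] m by (simp add: m_def)
  obtain D where D: "(v has_real_derivative D) (at x0)"
    using dv[OF x0p] by (auto simp: real_differentiable_def)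
  have "((\<lambda>u. (v u - v x0) / (u - x0)) \<longlongrightarrow> D) (at x0)"
    using D by (simp add: has_field_derivative_iff)
  then have "eventually (\<lambda>u. \<bar>(v u - v x0) / (u - x0)\<bar> < \<bar>D\<bar> + 1) (at x0)"
    by (intro order_tendstoD(2)[OF tendsto_rabs]) auto
  moreover have "eventually (\<lambda>u. h x0 / 2 < h u) (at x0)"
    using ch[OF x0p] h0 by (intro order_tendstoD(1)[of h "h x0"]) (auto simp: isCont_def)
  ultimately have "eventually (\<lambda>u. \<bar>(v u - v x0) / (u - x0)\<bar> < \<bar>D\<bar> + 1 \<and> h x0 / 2 < h u) (at x0)"
    by eventually_elim simp
  then obtain d where d: "d > 0"
    and dd: "\<And>u. u \<noteq> x0 \<Longrightarrow> dist u x0 < d \<Longrightarrow> \<bar>(v u - v x0) / (u - x0)\<bar> < \<bar>D\<bar> + 1 \<and> h x0 / 2 < h u"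
    unfolding eventually_at by auto
  \<comment> \<open>A bound for the difference quotients of \<open>v\<close> near \<open>x0\<close>;
    the added 1 makes the bound strict, so that it holds on a whole punctured neighbourhood.\<close>
  define C where "C = \<bar>D\<bar> + 1"
  have key: "h x0 / 2 \<le> C / (1 - \<alpha>) * e powr (1 - \<alpha>)" if e: "0 < e" "e < min d x0" for e
  proof -
    define s where "s = x0 - e"
    have s: "0 < s" "s < x0" using e by (auto simp: s_def)
    have near: "v u - m \<le> C * e" "h x0 / 2 < h u" if "s \<le> u" "u < x0" for u
    proof -
      have "\<bar>v u - v x0\<bar> / \<bar>u - x0\<bar> < C \<and> h x0 / 2 < h u"
        using dd[of u] that e by (auto simp: dist_real_def s_def C_def)
      then have "\<bar>v u - v x0\<bar> < C * \<bar>u - x0\<bar>" and *: "h x0 / 2 < h u" using that by (auto simp: field_simps)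
      moreover have "C * \<bar>u - x0\<bar> \<le> C * e" using that by (intro mult_left_mono) (auto simp: s_def C_def)
      ultimately show "v u - m \<le> C * e" unfolding m_def by linarith
      show "h x0 / 2 < h u" by fact
    qed
    let ?k = "\<lambda>x u. indicator {0<..<x} u * (x - u) powr (-\<alpha>)"
    \<comment> \<open>Subtracting the minimum \<open>m\<close> instead of \<open>v 0\<close> makes
      the integrand nonnegative on \<open>(0, x0)\<close>. The correction is an explicit multiple of
      the kernel integral.\<close>
    let ?F = "\<lambda>x u. ?k x u * (v u - m)"
    have split: "?F x u = indicator {0<..<x} u * ((x - u) powr (-\<alpha>) * (v u - v 0)) + (v 0 - m) * ?k x u" for x u
      by (simp add: algebra_simps)
    have F: "integrable lborel (?F x)"
       "integral\<^sup>L lborel (?F x) = (\<integral>u. indicator {0<..<x} u * h u \<partial>lborel) + (v 0 - m) * (x powr (1 - \<alpha>) / (1 - \<alpha>))"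
      if "0 < x" for x
    proof -
      note k = has_bochner_integral_kernel[OF al(2) that]
      show "integrable lborel (?F x)"
        unfolding split using vi[OF that] integrable.intros[OF k] by (intro Bochner_Integration.integrable_add) auto
      show "integral\<^sup>L lborel (?F x) = (\<integral>u. indicator {0<..<x} u * h u \<partial>lborel) + (v 0 - m) * (x powr (1 - \<alpha>) / (1 - \<alpha>))"
        unfolding split using vi[OF that] integrable.intros[OF k] has_bochner_integral_integral_eq[OF k] eq[OF that]
        by (subst Bochner_Integration.integral_add) auto
    qed
    have "integral\<^sup>L lborel (\<lambda>u. ?F x0 u - ?F s u) \<le> integral\<^sup>L lborel (\<lambda>u. (C * e) * (indicator {s..<x0} u * (x0 - u) powr (-\<alpha>)))"
    proof (rule integral_mono_AE)
      have kk: "integrable lborel (?k x0)" using has_bochner_integral_kernel[OF al(2) x0p] by (rule integrable.intros)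
      have "(\<lambda>u. indicator {s..<x0} u * ?k x0 u) = (\<lambda>u. indicator {s..<x0} u * (x0 - u) powr (-\<alpha>))"
        using s by (auto simp: indicator_def)
      with integrable_real_mult_indicator[of "{s..<x0}" lborel, OF _ kk]
      have "integrable lborel (\<lambda>u. indicator {s..<x0} u * (x0 - u) powr (-\<alpha>))" by (simp add: mult.commute)
      then show "integrable lborel (\<lambda>u. (C * e) * (indicator {s..<x0} u * (x0 - u) powr (-\<alpha>)))" by simp
      show "integrable lborel (\<lambda>u. ?F x0 u - ?F s u)" using F(1) x0p s by simp
      show "AE u in lborel. ?F x0 u - ?F s u \<le> (C * e) * (indicator {s..<x0} u * (x0 - u) powr (-\<alpha>))"
      proof (rule AE_I2)
        fix u
        show "?F x0 u - ?F s u \<le> (C * e) * (indicator {s..<x0} u * (x0 - u) powr (-\<alpha>))"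
        proof (cases "0 < u \<and> u < x0")
          case False
          then show ?thesis using s by (auto simp: indicator_def)
        next
          case True
          then have vm: "0 \<le> v u - m" using min[of u] x0 by (simp add: m_def)
          show ?thesis
          \<comment> \<open>Left of \<open>s\<close>, moving the pole of the kernel from
            \<open>s\<close> to \<open>x0\<close> lowers its value, so the difference is
            nonpositive. On \<open>[s, x0)\<close> only the integrand for \<open>x0\<close> is left,
            and there \<open>v - m\<close> is at most \<open>C * e\<close>.\<close>
          proof (cases "u < s")
            case less: True
            have "(x0 - u) powr (-\<alpha>) \<le> (s - u) powr (-\<alpha>)"
              by (rule powr_mono2') (use al less s in auto)
            then have "(x0 - u) powr (-\<alpha>) * (v u - m) \<le> (s - u) powr (-\<alpha>) * (v u - m)"
              using vm by (rule mult_right_mono)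
            then show ?thesis using True less by (simp add: indicator_def)
          next
            case ge: False
            then have "(x0 - u) powr (-\<alpha>) * (v u - m) \<le> (x0 - u) powr (-\<alpha>) * (C * e)"
              using True by (intro mult_left_mono near) auto
            then show ?thesis using True ge by (simp add: indicator_def mult.commute)
          qed
        qed
      qed
    qed
    also have "\<dots> = C * e * (e powr (1 - \<alpha>) / (1 - \<alpha>))"
    proof -
      have "has_bochner_integral lborel (\<lambda>u. indicator {0<..<e} (- s + 1 * u) * (e - (- s + 1 * u)) powr (- \<alpha>)) (e powr (1 - \<alpha>) / (1 - \<alpha>))"
        using has_bochner_integral_kernel[OF al(2) e(1)]
        by (subst (asm) lborel_has_bochner_integral_real_affine_iff[where c = 1 and t = "- s"]) auto
      then have "integral\<^sup>L lborel (\<lambda>u. indicator {0<..<e} (u - s) * (x0 - u) powr (- \<alpha>)) = e powr (1 - \<alpha>) / (1 - \<alpha>)"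
        by (intro has_bochner_integral_integral_eq) (simp add: s_def algebra_simps)
      moreover have "integral\<^sup>L lborel (\<lambda>u. indicator {s..<x0} u * (x0 - u) powr (- \<alpha>))
          = integral\<^sup>L lborel (\<lambda>u. indicator {0<..<e} (u - s) * (x0 - u) powr (- \<alpha>))"
      proof (rule integral_cong_AE)
        show "AE u in lborel. indicator {s..<x0} u * (x0 - u) powr (- \<alpha>) = indicator {0<..<e} (u - s) * (x0 - u) powr (- \<alpha>)"
          using AE_lborel_singleton[of s] by eventually_elim (auto simp: indicator_def s_def)
      qed auto
      ultimately show ?thesis by simp
    qed
    finally have up: "integral\<^sup>L lborel (?F x0) - integral\<^sup>L lborel (?F s) \<le> C * e * (e powr (1 - \<alpha>) / (1 - \<alpha>))"
      using F(1)[OF x0p] F(1)[OF s(1)] by simp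
    have "e * (h x0 / 2) = (\<integral>u. indicator {s..<x0} u * (h x0 / 2) \<partial>lborel)"
      using s by (simp add: s_def)
    also have "\<dots> \<le> (\<integral>u. indicator {0<..<x0} u * h u - indicator {0<..<s} u * h u \<partial>lborel)"
    proof (rule integral_mono)
      show "integrable lborel (\<lambda>u. indicator {s..<x0} u * (h x0 / 2))" using s by simp
      show "integrable lborel (\<lambda>u. indicator {0<..<x0} u * h u - indicator {0<..<s} u * h u)"
        using hi x0p s by simp
      show "indicator {s..<x0} u * (h x0 / 2) \<le> indicator {0<..<x0} u * h u - indicator {0<..<s} u * h u" for u
        using near(2)[of u] s by (auto simp: indicator_def)
    qed
    also have "\<dots> = (\<integral>u. indicator {0<..<x0} u * h u \<partial>lborel) - (\<integral>u. indicator {0<..<s} u * h u \<partial>lborel)"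
      using hi x0p s by simp
    also have "\<dots> \<le> integral\<^sup>L lborel (?F x0) - integral\<^sup>L lborel (?F s)"
    proof -
      \<comment> \<open>Because \<open>m < 0 \<le> v 0\<close>, the correction term increases with
        the upper limit, so the difference of the \<open>?F\<close> integrals dominates the
        difference of the \<open>h\<close> integrals.\<close>
      have "s powr (1 - \<alpha>) \<le> x0 powr (1 - \<alpha>)" using s al by (intro powr_mono2) auto
      then have "(v 0 - m) * (s powr (1 - \<alpha>) / (1 - \<alpha>)) \<le> (v 0 - m) * (x0 powr (1 - \<alpha>) / (1 - \<alpha>))"
        using al v0 m by (intro mult_left_mono divide_right_mono) auto
      then show ?thesis using F(2)[OF x0p] F(2)[OF s(1)] by linarith
    qed
    also note up
    finally have "e * (h x0 / 2) \<le> e * (C / (1 - \<alpha>) * e powr (1 - \<alpha>))" by (simp add: mult_ac)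
    then show ?thesis using e(1) by (simp only: mult_le_cancel_left_pos)
  qed
  have "((\<lambda>e. C / (1 - \<alpha>) * e powr (1 - \<alpha>)) \<longlongrightarrow> 0) (at_right 0)"
    using al by real_asymp
  then have "eventually (\<lambda>e. C / (1 - \<alpha>) * e powr (1 - \<alpha>) < h x0 / 2) (at_right 0)"
    using h0 by (intro order_tendstoD(2)) auto
  moreover have "eventually (\<lambda>e. 0 < e \<and> e < min d x0) (at_right 0)"
    using d x0p by (auto simp: eventually_at_right_field intro!: exI[of _ "min d x0"])
  ultimately have "eventually (\<lambda>e::real. False) (at_right 0)"
    by eventually_elim (use key in force)
  then show False by simp
qed

section \<open>Sign, monotonicity and decay on the negative half-line\<close>

lemma kilbas_saigo_0: "kilbas_saigo a m l 0 = 1"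
  by (simp add: kilbas_saigo_def kilbas_saigo_coeff_def)

lemma kilbas_saigo_has_derivative:
  assumes "0 < \<alpha>" "\<alpha> < 1" "0 \<le> \<gamma>"
  shows "\<exists>D. (kilbas_saigo \<alpha> (1 + \<gamma>/\<alpha>) (\<gamma>/\<alpha>) has_real_derivative D) (at w)"
  using termdiffs_strong_converges_everywhere[OF summable_kilbas_saigo[OF assms], of w]
  unfolding kilbas_saigo_def[abs_def] by blast

lemma kilbas_saigo_powr_continuous_on:
  assumes "0 < \<alpha>" "\<alpha> < 1" "0 \<le> \<gamma>"
  shows "continuous_on {0..} (\<lambda>u. kilbas_saigo \<alpha> (1 + \<gamma>/\<alpha>) (\<gamma>/\<alpha>) (- z * u powr (\<alpha> + \<gamma>)))"
proof (rule continuous_on_compose2[of UNIV "kilbas_saigo \<alpha> (1 + \<gamma>/\<alpha>) (\<gamma>/\<alpha>)"])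
  show "continuous_on UNIV (kilbas_saigo \<alpha> (1 + \<gamma>/\<alpha>) (\<gamma>/\<alpha>))"
    using kilbas_saigo_has_derivative[OF assms] DERIV_isCont by (blast intro: continuous_at_imp_continuous_on)
  show "continuous_on {0..} (\<lambda>u. - z * u powr (\<alpha> + \<gamma>))"
    using assms by (intro continuous_intros continuous_on_powr') auto
qed auto

lemma kilbas_saigo_powr_differentiable:
  assumes "0 < \<alpha>" "\<alpha> < 1" "0 \<le> \<gamma>" "0 < x"
  shows "(\<lambda>u. kilbas_saigo \<alpha> (1 + \<gamma>/\<alpha>) (\<gamma>/\<alpha>) (- z * u powr (\<alpha> + \<gamma>))) differentiable (at x)"
proof -
  let ?g = "\<lambda>u. - z * u powr (\<alpha> + \<gamma>)"
  have g: "(?g has_real_derivative - z * ((\<alpha> + \<gamma>) * x powr (\<alpha> + \<gamma> - 1))) (at x)"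
    using assms by (auto intro!: derivative_eq_intros)
  obtain D where D: "(kilbas_saigo \<alpha> (1 + \<gamma>/\<alpha>) (\<gamma>/\<alpha>) has_real_derivative D) (at (?g x))"
    using kilbas_saigo_has_derivative[OF assms(1-3)] by blast
  show ?thesis
    unfolding real_differentiable_def by (rule exI, rule DERIV_chain2[where g = ?g, OF D g])
qed

text \<open>The maximum principle with \<open>z = 1\<close>: the right-hand side is a negative
  multiple of \<open>u powr \<gamma> * v\<close>, hence positive wherever \<open>v\<close> is
  negative. Every argument \<open>w\<close> is reached at the time
  \<open>w powr (1 / (\<alpha> + \<gamma>))\<close>.\<close>

lemma kilbas_saigo_nonneg:
  assumes al: "0 < \<alpha>" "\<alpha> < 1" "0 \<le> \<gamma>" and w: "0 \<le> w"
  shows "0 \<le> kilbas_saigo \<alpha> (1 + \<gamma>/\<alpha>) (\<gamma>/\<alpha>) (- w)"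
proof -
  let ?v = "\<lambda>u. kilbas_saigo \<alpha> (1 + \<gamma>/\<alpha>) (\<gamma>/\<alpha>) (- 1 * u powr (\<alpha> + \<gamma>))"
  let ?h = "\<lambda>u. - 1 * Gamma (1 - \<alpha>) * (u powr \<gamma> * ?v u)"
  have G: "Gamma (1 - \<alpha>) > 0" using al by (intro Gamma_real_pos) simp
  have v0: "?v 0 = 1" by (simp add: kilbas_saigo_0)
  note K = kilbas_saigo_fractional_integral[OF al, where z = 1]
  have eq: "indicator A u * ?h u = - 1 * Gamma (1 - \<alpha>) * (indicator A u * (u powr \<gamma> * ?v u))" for A u
    by (simp add: mult_ac)
  have "0 \<le> ?v (w powr (1 / (\<alpha> + \<gamma>)))"
  proof (rule fractional_maximum_principle[OF al(1,2), where v = ?v and h = ?h])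
    show "continuous_on {0..} ?v" using al by (rule kilbas_saigo_powr_continuous_on)
    show "?v differentiable (at x)" if "0 < x" for x
      using al that by (rule kilbas_saigo_powr_differentiable)
    show "isCont ?h x" if "0 < x" for x
      using differentiable_imp_continuous_within[OF kilbas_saigo_powr_differentiable[OF al that, of 1]] that
      by (intro continuous_intros) auto
    show "integrable lborel (\<lambda>u. indicator {0<..<x} u * ((x - u) powr (-\<alpha>) * (?v u - ?v 0)))" if "0 < x" for x
      unfolding v0 by (rule K(1)[OF that])
    show "integrable lborel (\<lambda>u. indicator {0<..<x} u * ?h u)" if "0 < x" for x
      unfolding eq using K(2)[OF that] by (rule integrable_mult_right)
    show "(\<integral>u. indicator {0<..<x} u * ((x - u) powr (-\<alpha>) * (?v u - ?v 0)) \<partial>lborel)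
        = (\<integral>u. indicator {0<..<x} u * ?h u \<partial>lborel)" if "0 < x" for x
      unfolding eq v0 K(3)[OF that] by simp
    show "0 < ?h x" if "0 < x" "?v x < 0" for x
    proof -
      have "Gamma (1 - \<alpha>) * (x powr \<gamma> * ?v x) < 0" using that G by (intro mult_pos_neg) auto
      then show ?thesis by linarith
    qed
  qed (auto simp: kilbas_saigo_0)
  moreover have "(w powr (1 / (\<alpha> + \<gamma>))) powr (\<alpha> + \<gamma>) = w"
    using al w by (simp add: powr_powr)
  ultimately show ?thesis by simp
qed

text \<open>The maximum principle for the difference of the solutions with parameters
  \<open>w\<close> and \<open>w'\<close>, which starts at 0. Up to a positive factor the right-hand
  side is \<open>w' y' - w y = (w' - w) y' + w (y' - y)\<close>. The first summand is nonnegative by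
  the sign of the solution, the second positive where the difference \<open>y - y'\<close> is
  negative.\<close>

lemma kilbas_saigo_antimono:
  assumes al: "0 < \<alpha>" "\<alpha> < 1" "0 \<le> \<gamma>" and w: "0 < w" "w \<le> w'"
  shows "kilbas_saigo \<alpha> (1 + \<gamma>/\<alpha>) (\<gamma>/\<alpha>) (- w') \<le> kilbas_saigo \<alpha> (1 + \<gamma>/\<alpha>) (\<gamma>/\<alpha>) (- w)"
proof -
  let ?y = "\<lambda>z u. kilbas_saigo \<alpha> (1 + \<gamma>/\<alpha>) (\<gamma>/\<alpha>) (- z * u powr (\<alpha> + \<gamma>))"
  let ?v = "\<lambda>u. ?y w u - ?y w' u"
  let ?g = "\<lambda>z u. - z * Gamma (1 - \<alpha>) * (u powr \<gamma> * ?y z u)"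
  let ?h = "\<lambda>u. ?g w u - ?g w' u"
  have G: "Gamma (1 - \<alpha>) > 0" using al by (intro Gamma_real_pos) simp
  have v0: "?v 0 = 0" by (simp add: kilbas_saigo_0)
  note K = kilbas_saigo_fractional_integral[OF al]
  have eq1: "indicator A u * ?h u = - w * Gamma (1 - \<alpha>) * (indicator A u * (u powr \<gamma> * ?y w u))
      - (- w' * Gamma (1 - \<alpha>) * (indicator A u * (u powr \<gamma> * ?y w' u)))" for A u
    by (simp add: algebra_simps)
  have eq2: "indicator A u * (k * (?v u - ?v 0)) = indicator A u * (k * (?y w u - 1)) - indicator A u * (k * (?y w' u - 1))"
    for A u k unfolding v0 by (simp add: algebra_simps)
  have "0 \<le> ?v 1"
  proof (rule fractional_maximum_principle[OF al(1,2), where v = ?v and h = ?h])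
    show "continuous_on {0..} ?v"
      by (intro continuous_on_diff kilbas_saigo_powr_continuous_on al)
    show "?v differentiable (at x)" if "0 < x" for x
      by (intro differentiable_diff kilbas_saigo_powr_differentiable al that)
    show "isCont ?h x" if "0 < x" for x
      using differentiable_imp_continuous_within[OF kilbas_saigo_powr_differentiable[OF al that, of w]]
        differentiable_imp_continuous_within[OF kilbas_saigo_powr_differentiable[OF al that, of w']] that
      by (intro continuous_intros) auto
    show "integrable lborel (\<lambda>u. indicator {0<..<x} u * ((x - u) powr (-\<alpha>) * (?v u - ?v 0)))" if "0 < x" for x
      unfolding eq2 by (intro Bochner_Integration.integrable_diff K(1)[OF that])
    show "integrable lborel (\<lambda>u. indicator {0<..<x} u * ?h u)" if "0 < x" for x
      unfolding eq1 by (intro Bochner_Integration.integrable_diff integrable_mult_right K(2)[OF that])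
    show "(\<integral>u. indicator {0<..<x} u * ((x - u) powr (-\<alpha>) * (?v u - ?v 0)) \<partial>lborel)
        = (\<integral>u. indicator {0<..<x} u * ?h u \<partial>lborel)" if "0 < x" for x
      unfolding eq1 eq2 Bochner_Integration.integral_diff[OF K(1)[OF that] K(1)[OF that]] K(3)[OF that]
      using K(2)[OF that, of w] K(2)[OF that, of w']
      by (subst Bochner_Integration.integral_diff) (auto intro!: integrable_mult_right)
    show "0 < ?h x" if "0 < x" "?v x < 0" for x
    proof -
      have "0 \<le> (w' - w) * ?y w' x"
        using kilbas_saigo_nonneg[OF al, of "w' * x powr (\<alpha> + \<gamma>)"] w by (intro mult_nonneg_nonneg) auto
      moreover have "0 < w * (?y w' x - ?y w x)" using w that by (intro mult_pos_pos) auto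
      ultimately have "0 < w' * ?y w' x - w * ?y w x" by (simp add: algebra_simps)
      then have "0 < (Gamma (1 - \<alpha>) * x powr \<gamma>) * (w' * ?y w' x - w * ?y w x)"
        using G that by (intro mult_pos_pos) auto
      then show ?thesis by (simp add: algebra_simps)
    qed
  qed (auto simp: kilbas_saigo_0)
  then show ?thesis by simp
qed

text \<open>The integrated equation at \<open>x = 1\<close>. Its kernel side is at least
  \<open>- 1 / (1 - \<alpha>)\<close> because the solution is nonnegative. The integral of
  \<open>u powr \<gamma>\<close> times the solution is at least the value at 1 divided by
  \<open>\<gamma> + 1\<close>, because the solution decreases. Comparing the two gives the rate
  \<open>1 / w\<close>.\<close>

lemma kilbas_saigo_decay:
  assumes al: "0 < \<alpha>" "\<alpha> < 1" "0 \<le> \<gamma>" and w: "0 < w"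
  shows "kilbas_saigo \<alpha> (1 + \<gamma>/\<alpha>) (\<gamma>/\<alpha>) (- w) \<le> (\<gamma> + 1) / ((1 - \<alpha>) * Gamma (1 - \<alpha>)) / w"
proof -
  let ?y = "\<lambda>u. kilbas_saigo \<alpha> (1 + \<gamma>/\<alpha>) (\<gamma>/\<alpha>) (- w * u powr (\<alpha> + \<gamma>))"
  define Y where "Y = kilbas_saigo \<alpha> (1 + \<gamma>/\<alpha>) (\<gamma>/\<alpha>) (- w)"
  have G: "Gamma (1 - \<alpha>) > 0" using al by (intro Gamma_real_pos) simp
  note K = kilbas_saigo_fractional_integral[OF al zero_less_one, where z = w]
  note k = has_bochner_integral_kernel[OF al(2) zero_less_one]
  have P: "has_bochner_integral lborel (\<lambda>u. indicator {0<..<1} u * u powr \<gamma>) (1 powr (\<gamma> + 1) / (\<gamma> + 1))"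
    by (rule has_bochner_integral_powr) (use al in auto)
  have "Y * (1 powr (\<gamma> + 1) / (\<gamma> + 1)) = (\<integral>u. Y * (indicator {0<..<1} u * u powr \<gamma>) \<partial>lborel)"
    using has_bochner_integral_integral_eq[OF P] by simp
  also have "\<dots> \<le> (\<integral>u. indicator {0<..<1} u * (u powr \<gamma> * ?y u) \<partial>lborel)"
  proof (rule integral_mono)
    show "integrable lborel (\<lambda>u. Y * (indicator {0<..<1} u * u powr \<gamma>))"
      using integrable.intros[OF P] by simp
    show "Y * (indicator {0<..<1} u * u powr \<gamma>) \<le> indicator {0<..<1} u * (u powr \<gamma> * ?y u)" for u
    proof (cases "u \<in> {0<..<1}")
      case True
      have "w * u powr (\<alpha> + \<gamma>) \<le> w * 1 powr (\<alpha> + \<gamma>)"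
        using True w al by (intro mult_left_mono powr_mono2) auto
      then have "Y \<le> ?y u" unfolding Y_def
        using kilbas_saigo_antimono[OF al, of "w * u powr (\<alpha> + \<gamma>)" w] True w by simp
      then have "Y * u powr \<gamma> \<le> ?y u * u powr \<gamma>" by (rule mult_right_mono) simp
      then show ?thesis using True by (simp add: mult.commute)
    qed simp
  qed (rule K(2))
  finally have 1: "Y / (\<gamma> + 1) \<le> (\<integral>u. indicator {0<..<1} u * (u powr \<gamma> * ?y u) \<partial>lborel)" by simp
  have "- (1 powr (1 - \<alpha>) / (1 - \<alpha>)) = (\<integral>u. - (indicator {0<..<1} u * (1 - u) powr (-\<alpha>)) \<partial>lborel)"
    using has_bochner_integral_integral_eq[OF k] by simp
  also have "\<dots> \<le> (\<integral>u. indicator {0<..<1} u * ((1 - u) powr (-\<alpha>) * (?y u - 1)) \<partial>lborel)"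
  proof (rule integral_mono)
    show "integrable lborel (\<lambda>u. - (indicator {0<..<1} u * (1 - u) powr (-\<alpha>)))"
      using integrable.intros[OF k] by simp
    show "- (indicator {0<..<1} u * (1 - u) powr (-\<alpha>)) \<le> indicator {0<..<1} u * ((1 - u) powr (-\<alpha>) * (?y u - 1))" for u :: real
    proof -
      have "0 \<le> ?y u" using kilbas_saigo_nonneg[OF al, of "w * u powr (\<alpha> + \<gamma>)"] w by simp
      then have "(1 - u) powr (-\<alpha>) * (-1) \<le> (1 - u) powr (-\<alpha>) * (?y u - 1)"
        by (intro mult_left_mono) auto
      then show ?thesis by (simp add: indicator_def)
    qed
  qed (rule K(1))
  finally have "w * Gamma (1 - \<alpha>) * (\<integral>u. indicator {0<..<1} u * (u powr \<gamma> * ?y u) \<partial>lborel) \<le> 1 / (1 - \<alpha>)"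
    unfolding K(3) by simp
  moreover have "w * Gamma (1 - \<alpha>) * (Y / (\<gamma> + 1)) \<le> w * Gamma (1 - \<alpha>) * (\<integral>u. indicator {0<..<1} u * (u powr \<gamma> * ?y u) \<partial>lborel)"
    using 1 w G by (intro mult_left_mono) auto
  ultimately have "w * Gamma (1 - \<alpha>) * (Y / (\<gamma> + 1)) \<le> 1 / (1 - \<alpha>)" by linarith
  then show ?thesis unfolding Y_def[symmetric] using w G al by (simp add: field_simps)
qed

section \<open>Orthonormal expansions\<close>

lemma integrable_mult_square_integrable:
  fixes f g :: "'a \<Rightarrow> real"
  assumes "f \<in> borel_measurable M" "g \<in> borel_measurable M"
    and "integrable M (\<lambda>x. (f x)\<^sup>2)" "integrable M (\<lambda>x. (g x)\<^sup>2)"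
  shows "integrable M (\<lambda>x. f x * g x)"
proof (rule Bochner_Integration.integrable_bound)
  show "integrable M (\<lambda>x. (f x)\<^sup>2 + (g x)\<^sup>2)" using assms by simp
  show "AE x in M. norm (f x * g x) \<le> norm ((f x)\<^sup>2 + (g x)\<^sup>2)"
  proof (rule AE_I2)
    fix x
    have "0 \<le> (\<bar>f x\<bar> - \<bar>g x\<bar>)\<^sup>2" by simp
    then have "2 * (\<bar>f x\<bar> * \<bar>g x\<bar>) \<le> (f x)\<^sup>2 + (g x)\<^sup>2" by (simp add: power2_diff)
    moreover have "0 \<le> \<bar>f x\<bar> * \<bar>g x\<bar>" by simp
    ultimately have "\<bar>f x\<bar> * \<bar>g x\<bar> \<le> (f x)\<^sup>2 + (g x)\<^sup>2" by linarith
    then show "norm (f x * g x) \<le> norm ((f x)\<^sup>2 + (g x)\<^sup>2)" by (simp add: abs_mult)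
  qed
qed (use assms in measurable)

text \<open>The measure stays abstract because two instances are used: the polynomials
  \<open>Q n\<close> with the gamma weight, and their normalised derivatives with the weight
  multiplied by \<open>x\<close>.\<close>

locale orthonormal_system =
  fixes M :: "'a measure" and e :: "nat \<Rightarrow> 'a \<Rightarrow> real"
  assumes measurable_e[measurable]: "e n \<in> borel_measurable M"
    and integrable_e: "integrable M (\<lambda>x. e i x * e j x)"
    and orthonormal: "(\<integral>x. e i x * e j x \<partial>M) = (if i = j then 1 else 0)"
begin

lemma integrable_e_square: "integrable M (\<lambda>x. (e n x)\<^sup>2)"
  using integrable_e[of n n] by (simp add: power2_eq_square)

lemma
  fixes k :: "nat \<Rightarrow> real"
  assumes "finite A"
  shows integrable_sum_square: "integrable M (\<lambda>x. (\<Sum>n\<in>A. k n * e n x)\<^sup>2)"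
    and integral_sum_square: "(\<integral>x. (\<Sum>n\<in>A. k n * e n x)\<^sup>2 \<partial>M) = (\<Sum>n\<in>A. (k n)\<^sup>2)"
proof -
  have eq: "(\<Sum>n\<in>A. k n * e n x)\<^sup>2 = (\<Sum>i\<in>A. \<Sum>j\<in>A. k i * k j * (e i x * e j x))" for x
    by (simp add: power2_eq_square sum_product mult_ac)
  show "integrable M (\<lambda>x. (\<Sum>n\<in>A. k n * e n x)\<^sup>2)"
    unfolding eq by (intro Bochner_Integration.integrable_sum integrable_mult_right integrable_e)
  have "(\<integral>x. (\<Sum>n\<in>A. k n * e n x)\<^sup>2 \<partial>M) = (\<Sum>i\<in>A. \<Sum>j\<in>A. k i * k j * (if i = j then 1 else 0))"
    unfolding eq
    by (subst Bochner_Integration.integral_sum, (intro Bochner_Integration.integrable_sum integrable_mult_right integrable_e),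
        rule sum.cong[OF refl],
        subst Bochner_Integration.integral_sum, (intro integrable_mult_right integrable_e),
        simp add: orthonormal)
  also have "\<dots> = (\<Sum>n\<in>A. (k n)\<^sup>2)"
    using assms by (simp add: if_distrib[of "\<lambda>c. _ * c"] power2_eq_square cong: if_cong)
  finally show "(\<integral>x. (\<Sum>n\<in>A. k n * e n x)\<^sup>2 \<partial>M) = (\<Sum>n\<in>A. (k n)\<^sup>2)" .
qed

lemma
  fixes g :: "'a \<Rightarrow> real" and k :: "nat \<Rightarrow> real"
  assumes g: "g \<in> borel_measurable M" "integrable M (\<lambda>x. (g x)\<^sup>2)"
  shows integrable_mult_e: "integrable M (\<lambda>x. g x * e n x)"
    and integral_mult_sum: "(\<integral>x. g x * (\<Sum>n\<in>A. k n * e n x) \<partial>M) = (\<Sum>n\<in>A. k n * (\<integral>x. g x * e n x \<partial>M))"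
proof -
  show i: "integrable M (\<lambda>x. g x * e n x)" for n
    using g integrable_e_square by (intro integrable_mult_square_integrable) auto
  have "(\<integral>x. g x * (\<Sum>n\<in>A. k n * e n x) \<partial>M) = (\<integral>x. (\<Sum>n\<in>A. k n * (g x * e n x)) \<partial>M)"
    by (simp add: sum_distrib_left mult_ac)
  also have "\<dots> = (\<Sum>n\<in>A. k n * (\<integral>x. g x * e n x \<partial>M))"
    using i by (subst Bochner_Integration.integral_sum) auto
  finally show "(\<integral>x. g x * (\<Sum>n\<in>A. k n * e n x) \<partial>M) = (\<Sum>n\<in>A. k n * (\<integral>x. g x * e n x \<partial>M))" .
qed

text \<open>The squared distance from \<open>g\<close> to its projection onto the first
  \<open>N\<close> functions is nonnegative; expanding it bounds the partial sums by the squared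
  norm of \<open>g\<close>, uniformly in \<open>N\<close>.\<close>

lemma Bessel:
  fixes g :: "'a \<Rightarrow> real"
  assumes g: "g \<in> borel_measurable M" "integrable M (\<lambda>x. (g x)\<^sup>2)"
  shows "summable (\<lambda>n. (\<integral>x. g x * e n x \<partial>M)\<^sup>2)"
proof (rule summableI_nonneg_bounded)
  define a where "a n = (\<integral>x. g x * e n x \<partial>M)" for n
  fix N
  let ?s = "\<lambda>x. \<Sum>n<N. a n * e n x"
  have s: "integrable M (\<lambda>x. (?s x)\<^sup>2)" by (rule integrable_sum_square) simp
  have gs: "integrable M (\<lambda>x. g x * ?s x)" using g s by (intro integrable_mult_square_integrable) auto
  have "0 \<le> (\<integral>x. (g x - ?s x)\<^sup>2 \<partial>M)" by simp
  also have "\<dots> = (\<integral>x. (g x)\<^sup>2 - 2 * (g x * ?s x) + (?s x)\<^sup>2 \<partial>M)"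
    by (simp add: power2_diff algebra_simps)
  also have "\<dots> = (\<integral>x. (g x)\<^sup>2 \<partial>M) - 2 * (\<integral>x. g x * ?s x \<partial>M) + (\<integral>x. (?s x)\<^sup>2 \<partial>M)"
    using g(2) s gs by (simp add: Bochner_Integration.integral_add Bochner_Integration.integral_diff)
  also have "\<dots> = (\<integral>x. (g x)\<^sup>2 \<partial>M) - (\<Sum>n<N. (a n)\<^sup>2)"
    unfolding integral_mult_sum[OF g] integral_sum_square[OF finite_lessThan]
    by (simp add: a_def[symmetric] power2_eq_square)
  finally show "(\<Sum>n<N. (\<integral>x. g x * e n x \<partial>M)\<^sup>2) \<le> (\<integral>x. (g x)\<^sup>2 \<partial>M)" by (simp add: a_def)
qed simp

text \<open>The pointwise sum has to be identified with the sum in mean square. Fatou's lemma does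
  this by bounding the mean-square error of the partial sums through the tail of the coefficients;
  integration against \<open>g\<close> is then continuous.\<close>

lemma integral_mult_suminf:
  fixes g :: "'a \<Rightarrow> real" and k :: "nat \<Rightarrow> real"
  assumes g: "g \<in> borel_measurable M" "integrable M (\<lambda>x. (g x)\<^sup>2)"
    and k: "summable (\<lambda>n. (k n)\<^sup>2)"
    and pw: "AE x in M. summable (\<lambda>n. k n * e n x)"
  shows "(\<lambda>n. k n * (\<integral>x. g x * e n x \<partial>M)) sums (\<integral>x. g x * (\<Sum>n. k n * e n x) \<partial>M)"
proof -
  define K where "K x = (\<Sum>n. k n * e n x)" for x
  define s where "s N x = (\<Sum>n<N. k n * e n x)" for N x
  define T where "T N = (\<Sum>n. (k (n + N))\<^sup>2)" for N
  have [measurable]: "K \<in> borel_measurable M" unfolding K_def[abs_def] by measurable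
  have [measurable]: "s N \<in> borel_measurable M" for N unfolding s_def[abs_def] by measurable
  have T0: "0 \<le> T N" for N unfolding T_def using summable_ignore_initial_segment[OF k, of N] by (intro suminf_nonneg) auto
  have part: "(\<integral>\<^sup>+x. ennreal ((s m x - s N x)\<^sup>2) \<partial>M) \<le> ennreal (T N)" if "N \<le> m" for N m
  proof -
    have eq: "s m x - s N x = (\<Sum>n\<in>{N..<m}. k n * e n x)" for x
      unfolding s_def using that by (simp add: lessThan_atLeast0 sum_diff_nat_ivl)
    have "(\<integral>\<^sup>+x. ennreal ((s m x - s N x)\<^sup>2) \<partial>M) = ennreal (\<Sum>n\<in>{N..<m}. (k n)\<^sup>2)"
      unfolding eq using integrable_sum_square[of "{N..<m}" k] integral_sum_square[of "{N..<m}" k]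
      by (subst nn_integral_eq_integral) auto
    also have "(\<Sum>n\<in>{N..<m}. (k n)\<^sup>2) = (\<Sum>n<m-N. (k (n + N))\<^sup>2)"
      using sum.shift_bounds_nat_ivl[of "\<lambda>n. (k n)\<^sup>2" 0 N "m - N"] that by (simp add: lessThan_atLeast0)
    also have "\<dots> \<le> T N" unfolding T_def
      using summable_ignore_initial_segment[OF k, of N] by (intro sum_le_suminf) auto
    finally show ?thesis by (simp add: ennreal_leI)
  qed
  \<comment> \<open>Fatou's lemma in \<open>m\<close>: the integrands converge almost everywhere to
    the squared remainder, while each integral is bounded by \<open>T N\<close> once
    \<open>m \<ge> N\<close>.\<close>
  have tail: "(\<integral>\<^sup>+x. ennreal ((K x - s N x)\<^sup>2) \<partial>M) \<le> ennreal (T N)" for N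
  proof -
    have "AE x in M. ennreal ((K x - s N x)\<^sup>2) = liminf (\<lambda>m. ennreal ((s m x - s N x)\<^sup>2))"
      using pw
    proof eventually_elim
      case (elim x)
      then have "(\<lambda>m. s m x) \<longlonglongrightarrow> K x" unfolding s_def K_def by (rule summable_LIMSEQ)
      then have "(\<lambda>m. ennreal ((s m x - s N x)\<^sup>2)) \<longlonglongrightarrow> ennreal ((K x - s N x)\<^sup>2)"
        by (intro tendsto_intros)
      then show ?case by (intro lim_imp_Liminf[symmetric]) auto
    qed
    then have "(\<integral>\<^sup>+x. ennreal ((K x - s N x)\<^sup>2) \<partial>M) = (\<integral>\<^sup>+x. liminf (\<lambda>m. ennreal ((s m x - s N x)\<^sup>2)) \<partial>M)"
      by (rule nn_integral_cong_AE)
    also have "\<dots> \<le> liminf (\<lambda>m. \<integral>\<^sup>+x. ennreal ((s m x - s N x)\<^sup>2) \<partial>M)"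
      by (rule nn_integral_liminf) measurable
    also have "\<dots> \<le> liminf (\<lambda>m. ennreal (T N))"
      by (rule Liminf_mono) (use part in \<open>auto simp: eventually_sequentially\<close>)
    also have "\<dots> = ennreal (T N)" by (simp add: Liminf_const)
    finally show ?thesis .
  qed
  have Ri: "integrable M (\<lambda>x. (K x - s N x)\<^sup>2)" for N
    using tail[of N] by (intro integrableI_bounded) (auto simp: less_top[symmetric] top_unique)
  have RT: "(\<integral>x. (K x - s N x)\<^sup>2 \<partial>M) \<le> T N" for N
    using tail[of N] T0 nn_integral_eq_integral[OF Ri[of N]] by simp
  have T: "T \<longlonglongrightarrow> 0"
    unfolding T_def using suminf_exist_split2[OF k] .
  have gK: "integrable M (\<lambda>x. g x * (K x - s N x))" for N
    using g Ri by (intro integrable_mult_square_integrable) auto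
  have gs: "integrable M (\<lambda>x. g x * s N x)" for N
    using g integrable_sum_square[of "{..<N}" k] unfolding s_def
    by (intro integrable_mult_square_integrable) auto
  \<comment> \<open>The case \<open>N = 0\<close>, where the partial sum is empty.\<close>
  have gKK: "integrable M (\<lambda>x. g x * K x)"
    using gK[of 0] by (simp add: s_def)
  define G where "G = (\<integral>x. (g x)\<^sup>2 \<partial>M)"
  have G0: "0 \<le> G" by (simp add: G_def)
  \<comment> \<open>A weighted arithmetic-geometric inequality in the role of Cauchy-Schwarz: the
    free parameter \<open>d\<close> makes the first summand small, then \<open>N\<close> the
    second.\<close>
  have bound: "\<bar>(\<integral>x. g x * K x \<partial>M) - (\<integral>x. g x * s N x \<partial>M)\<bar> \<le> d * G + T N / d" if d: "0 < d" for d N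
  proof -
    have "(\<integral>x. g x * K x \<partial>M) - (\<integral>x. g x * s N x \<partial>M) = (\<integral>x. g x * (K x - s N x) \<partial>M)"
      using gKK gs by (simp add: right_diff_distrib)
    also have "\<bar>\<dots>\<bar> \<le> (\<integral>x. \<bar>g x * (K x - s N x)\<bar> \<partial>M)" by (rule integral_abs_bound)
    also have "\<dots> \<le> (\<integral>x. d * (g x)\<^sup>2 + (K x - s N x)\<^sup>2 / d \<partial>M)"
    proof (rule integral_mono)
      fix x
      let ?a = "\<bar>g x\<bar>" and ?b = "\<bar>K x - s N x\<bar>"
      have "0 \<le> (d * ?a - ?b)\<^sup>2" by simp
      then have "2 * d * (?a * ?b) \<le> d\<^sup>2 * ?a\<^sup>2 + ?b\<^sup>2" by (simp add: power2_diff power_mult_distrib mult_ac)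
      moreover have "0 \<le> d * (?a * ?b)" using d by simp
      ultimately have "d * (?a * ?b) \<le> d\<^sup>2 * (g x)\<^sup>2 + (K x - s N x)\<^sup>2" by (simp only: power2_abs)
      then have "?a * ?b \<le> (d\<^sup>2 * (g x)\<^sup>2 + (K x - s N x)\<^sup>2) / d" using d by (simp add: field_simps)
      also have "\<dots> = d * (g x)\<^sup>2 + (K x - s N x)\<^sup>2 / d" using d by (simp add: field_simps power2_eq_square)
      finally show "\<bar>g x * (K x - s N x)\<bar> \<le> d * (g x)\<^sup>2 + (K x - s N x)\<^sup>2 / d" by (simp add: abs_mult)
    qed (use g Ri gK in auto)
    also have "\<dots> = d * G + (\<integral>x. (K x - s N x)\<^sup>2 \<partial>M) / d"
      unfolding G_def using g Ri by simp
    also have "\<dots> \<le> d * G + T N / d" using RT[of N] d by (simp add: divide_right_mono)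
    finally show ?thesis .
  qed
  have "(\<lambda>N. \<integral>x. g x * s N x \<partial>M) \<longlonglongrightarrow> (\<integral>x. g x * K x \<partial>M)"
  proof (rule LIMSEQ_I)
    fix r :: real assume r: "0 < r"
    \<comment> \<open>Chosen so that \<open>d * G < r / 2\<close>; the added 1 covers the case
      \<open>G = 0\<close>.\<close>
    define d where "d = r / (2 * (G + 1))"
    have d: "0 < d" using r G0 by (simp add: d_def)
    have "d * G < r / 2" using r G0 by (simp add: d_def field_simps)
    moreover obtain N0 where N0: "\<And>N. N \<ge> N0 \<Longrightarrow> T N < d * (r / 2)"
      using order_tendstoD(2)[OF T, of "d * (r / 2)"] d r by (auto simp: eventually_sequentially)
    moreover have "T N / d < r / 2" if "T N < d * (r / 2)" for N using that d by (simp add: field_simps)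
    ultimately have "norm ((\<integral>x. g x * s N x \<partial>M) - (\<integral>x. g x * K x \<partial>M)) < r" if "N \<ge> N0" for N
      using bound[OF d, of N] that by (smt (verit) real_norm_def field_sum_of_halves)
    then show "\<exists>N0. \<forall>N\<ge>N0. norm ((\<integral>x. g x * s N x \<partial>M) - (\<integral>x. g x * K x \<partial>M)) < r" by blast
  qed
  then show ?thesis
    unfolding sums_def K_def s_def integral_mult_sum[OF g] .
qed

end

section \<open>Laguerre polynomials\<close>

lemma borel_measurable_poly [measurable]: "poly (p :: real poly) \<in> borel_measurable borel"
  by (intro borel_measurable_continuous_onI continuous_intros)

lemma borel_measurable_gamma_dens [measurable]: "gamma_dens a b \<in> borel_measurable borel"
  unfolding gamma_dens_def[abs_def] by measurable

lemma gamma_dens_pos: "a > 0 \<Longrightarrow> b > 0 \<Longrightarrow> x > 0 \<Longrightarrow> gamma_dens a b x > 0"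
  by (simp add: gamma_dens_def)

lemma gamma_dens_nonneg: "b > 0 \<Longrightarrow> gamma_dens a b x \<ge> 0"
  by (simp add: gamma_dens_def Gamma_real_pos less_imp_le)

lemma has_bochner_integral_gamma_dens:
  assumes "a > 0" "b > 0"
  shows "has_bochner_integral lborel (\<lambda>x. indicator {0<..} x * gamma_dens a b x) 1"
proof -
  have "((\<lambda>t. t powr (b - 1) / exp t) has_integral Gamma b) {0..}"
    using assms(2) by (rule Gamma_integral_real)
  then have "has_bochner_integral lborel (\<lambda>t. indicator {0..} t * (t powr (b - 1) / exp t)) (Gamma b)"
    by (intro has_bochner_integral_of_has_integral) auto
  \<comment> \<open>The endpoint contributes nothing because \<open>0 powr (b - 1) = 0\<close>,
    whatever the sign of the exponent.\<close>
  moreover have "indicator {0..} t * (t powr (b - 1) / exp t) = indicator {0<..} t * (t powr (b - 1) / exp t)" for t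
    by (cases "t = 0") (auto simp: indicator_def)
  ultimately have "has_bochner_integral lborel (\<lambda>t. indicator {0<..} t * (t powr (b - 1) / exp t)) (Gamma b)"
    by (simp only:)
  then have "has_bochner_integral lborel
      (\<lambda>t. indicator {0<..} (0 + a * t) * ((0 + a * t) powr (b - 1) / exp (0 + a * t))) (Gamma b /\<^sub>R \<bar>a\<bar>)"
    using assms by (subst (asm) lborel_has_bochner_integral_real_affine_iff[where c = a and t = 0]) auto
  then have "has_bochner_integral lborel
      (\<lambda>t. a / Gamma b * (indicator {0<..} (0 + a * t) * ((0 + a * t) powr (b - 1) / exp (0 + a * t))))
      (a / Gamma b * (Gamma b /\<^sub>R \<bar>a\<bar>))"
    by (rule has_bochner_integral_mult_right)
  moreover have "a / Gamma b * (Gamma b /\<^sub>R \<bar>a\<bar>) = 1"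
    using assms Gamma_real_pos[of b] by (simp add: less_imp_neq[symmetric])
  moreover have "a / Gamma b * (indicator {0<..} (0 + a * t) * ((0 + a * t) powr (b - 1) / exp (0 + a * t)))
      = indicator {0<..} t * gamma_dens a b t" for t
  proof (cases "0 < t")
    case True
    have "a * a powr (b - 1) = a powr b" using assms by (simp add: powr_diff)
    with True assms show ?thesis
      by (simp add: gamma_dens_def powr_mult exp_minus inverse_eq_divide)
  qed (use assms in \<open>simp add: indicator_def zero_less_mult_iff\<close>)
  ultimately show ?thesis by simp
qed

lemma gamma_dens_Suc:
  assumes "a > 0" "b > 0" "x > 0"
  shows "x * gamma_dens a b x = b / a * gamma_dens a (b + 1) x"
proof -
  have "Gamma (b + 1) = b * Gamma b" using assms by (intro Gamma_plus1) (auto simp: nonpos_Ints_def)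
  moreover have "x * x powr (b - 1) = x powr b" "a powr (b + 1) = a * a powr b"
    using assms by (simp_all add: powr_diff powr_add)
  moreover have "Gamma b > 0" using assms by simp
  ultimately show ?thesis using assms by (simp add: gamma_dens_def field_simps)
qed

lemma gamma_dens_power:
  assumes "a > 0" "b > 0" "x > 0"
  shows "x ^ n * gamma_dens a b x = pochhammer b n / a ^ n * gamma_dens a (b + real n) x"
proof (induction n)
  case (Suc n)
  have "x ^ Suc n * gamma_dens a b x = pochhammer b n / a ^ n * (x * gamma_dens a (b + real n) x)"
    using Suc by (simp add: mult_ac)
  also have "\<dots> = pochhammer b (Suc n) / a ^ Suc n * gamma_dens a (b + real (Suc n)) x"
    using assms by (subst gamma_dens_Suc) (simp_all add: pochhammer_rec' field_simps)
  finally show ?case .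
qed simp

text \<open>Each factor \<open>x\<close> raises the shape parameter by one at the cost of a
  constant, so every moment follows from the total mass 1 of the density with shape
  \<open>b + n\<close>.\<close>

lemma has_bochner_integral_power_gamma_dens:
  assumes "a > 0" "b > 0"
  shows "has_bochner_integral lborel (\<lambda>x. indicator {0<..} x * (x ^ n * gamma_dens a b x)) (pochhammer b n / a ^ n)"
proof -
  have "indicator {0<..} x * (x ^ n * gamma_dens a b x)
      = pochhammer b n / a ^ n * (indicator {0<..} x * gamma_dens a (b + real n) x)" for x
    using gamma_dens_power[OF assms, of x n] by (simp add: indicator_def)
  then show ?thesis
    using has_bochner_integral_mult_right[OF has_bochner_integral_gamma_dens[of a "b + real n"], of "pochhammer b n / a ^ n"] assms
    by simp
qed

lemma integrable_poly_gamma_dens: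
  assumes "a > 0" "b > 0"
  shows "integrable lborel (\<lambda>x. indicator {0<..} x * (poly p x * gamma_dens a b x))"
proof -
  have "indicator {0<..} x * (poly p x * gamma_dens a b x)
     = (\<Sum>i\<le>degree p. coeff p i * (indicator {0<..} x * (x ^ i * gamma_dens a b x)))" for x :: real
    by (simp add: poly_altdef sum_distrib_left sum_distrib_right mult_ac)
  then show ?thesis
    using integrable.intros[OF has_bochner_integral_power_gamma_dens[OF assms]] by simp
qed

text \<open>Expectation under the gamma law as a linear functional on the polynomial ring.
  Orthogonality and integration by parts become identities between polynomials.\<close>

definition gamma_mean :: "real \<Rightarrow> real \<Rightarrow> real poly \<Rightarrow> real" where
  "gamma_mean a b p = (\<integral>x. indicator {0<..} x * (poly p x * gamma_dens a b x) \<partial>lborel)"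

section \<open>Laguerre polynomials and orthogonality of their derivatives\<close>

context
  fixes a b :: real
  assumes a: "a > 0" and b: "b > 0"
begin

lemma gamma_mean_add: "gamma_mean a b (p + q) = gamma_mean a b p + gamma_mean a b q"
  using integrable_poly_gamma_dens[OF a b, of p] integrable_poly_gamma_dens[OF a b, of q]
  unfolding gamma_mean_def by (simp flip: Bochner_Integration.integral_add add: algebra_simps)

lemma gamma_mean_smult: "gamma_mean a b (smult c p) = c * gamma_mean a b p"
proof -
  have "indicator {0<..} x * (poly (smult c p) x * gamma_dens a b x)
     = c * (indicator {0<..} x * (poly p x * gamma_dens a b x))" for x :: real by (simp add: mult_ac)
  then show ?thesis by (simp only: gamma_mean_def integral_mult_right_zero)
qed

lemma gamma_mean_monom: "gamma_mean a b (monom c n) = c * (pochhammer b n / a ^ n)"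
proof -
  have "indicator {0<..} x * (poly (monom c n) x * gamma_dens a b x)
     = c * (indicator {0<..} x * (x ^ n * gamma_dens a b x))" for x :: real by (simp add: poly_monom mult_ac)
  then show ?thesis
    using has_bochner_integral_integral_eq[OF has_bochner_integral_power_gamma_dens[OF a b, of n]]
    by (simp only: gamma_mean_def integral_mult_right_zero)
qed

text \<open>The total integral of \<open>(x m(x) p(x))'\<close> vanishes, since \<open>(x m(x))' = (b - a x) m(x)\<close>.\<close>
lemma gamma_mean_integration_by_parts: "gamma_mean a b ([:b, -a:] * p + [:0, 1:] * pderiv p) = 0"
proof -
  define A where "A p = [:b, -a:] * p + [:0, 1:] * pderiv p" for p
  have A_add: "A (p + q) = A p + A q" for p q by (simp add: A_def pderiv_add smult_add_right algebra_simps)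
  have A0: "A 0 = 0" by (simp add: A_def)
  \<comment> \<open>By linearity monomials suffice. For them the two moments cancel through the
    recursion of the rising factorial, so no boundary term has to be examined.\<close>
  have m: "gamma_mean a b (A (monom c n)) = 0" for c n
  proof -
    have "A (monom c n) = smult (b + real n) (monom c n) + smult (- a) (monom c (Suc n))"
      by (rule poly_eqI) (auto simp: A_def coeff_pCons coeff_pderiv algebra_simps split: nat.split)
    then show ?thesis
      using a by (simp only: gamma_mean_add gamma_mean_smult gamma_mean_monom pochhammer_rec') (simp add: field_simps)
  qed
  have "gamma_mean a b (A (\<Sum>i\<le>k. monom (coeff p i) i)) = 0" for k
    by (induction k) (simp_all add: A_add gamma_mean_add m)
  from this[of "degree p"] show ?thesis by (simp add: poly_as_sum_of_monoms A_def)
qed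

context
  fixes Q :: "nat \<Rightarrow> real poly"
  assumes Q: "orthonormal_polys (gamma_dens a b) Q"
begin

lemma degree_Q: "degree (Q n) = n"
  using Q by (simp add: orthonormal_polys_def)

lemma gamma_mean_Q: "gamma_mean a b (Q i * Q j) = (if i = j then 1 else 0)"
  using Q by (auto simp: orthonormal_polys_def set_lebesgue_integral_def gamma_mean_def)

lemma coeff_Q_neq_0: "coeff (Q n) n \<noteq> 0"
proof
  assume "coeff (Q n) n = 0"
  then have "Q n = 0" using degree_Q[of n] leading_coeff_0_iff[of "Q n"] by simp
  then show False using gamma_mean_Q[of n n] by (simp add: gamma_mean_def)
qed

text \<open>Orthogonality to lower degrees, by removing one leading term at a time with a multiple
  of \<open>Q n\<close>. Degree below \<open>n\<close> is expressed through vanishing coefficients,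
  so that \<open>n = 0\<close> means the zero polynomial.\<close>

lemma gamma_mean_mult_Q_eq_0:
  assumes "\<And>k. n \<le> k \<Longrightarrow> coeff p k = 0" and "n \<le> j"
  shows "gamma_mean a b (p * Q j) = 0"
  using assms
proof (induction n arbitrary: p)
  case 0
  then have "p = 0" by (intro poly_eqI) simp
  then show ?case by (simp add: gamma_mean_def)
next
  case (Suc n)
  define c where "c = coeff p n / coeff (Q n) n"
  define r where "r = p - smult c (Q n)"
  have "coeff r k = 0" if "n \<le> k" for k
  proof (cases "k = n")
    case True
    then show ?thesis using coeff_Q_neq_0[of n] by (simp add: r_def c_def)
  next
    case False
    with that Suc.prems(1)[of k] show ?thesis by (simp add: r_def coeff_eq_0 degree_Q)
  qed
  then have "gamma_mean a b (r * Q j) = 0" using Suc.prems(2) by (intro Suc.IH) auto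
  moreover have "p * Q j = r * Q j + smult c (Q n * Q j)" by (simp add: r_def algebra_simps)
  ultimately show ?case using Suc.prems(2) by (simp add: gamma_mean_add gamma_mean_smult gamma_mean_Q)
qed

text \<open>Integration by parts moves one derivative from \<open>Q j\<close> onto
  \<open>Q i\<close>, producing the Laguerre operator \<open>x Q'' + (b - a x) Q'\<close>. On degree
  \<open>i\<close> it acts as multiplication by \<open>- a * i\<close> up to lower degrees, and
  these are orthogonal to \<open>Q j\<close> for \<open>i \<le> j\<close>.\<close>

lemma gamma_mean_pderiv_Q:
  "gamma_mean a b ([:0, 1:] * (pderiv (Q i) * pderiv (Q j))) = (if i = j then a * real i else 0)"
proof -
  have le: "gamma_mean a b ([:0, 1:] * (pderiv (Q i) * pderiv (Q j))) = (if i = j then a * real i else 0)"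
    if "i \<le> j" for i j
  proof -
    define L where "L = [:b, -a:] * pderiv (Q i) + [:0, 1:] * pderiv (pderiv (Q i))"
    \<comment> \<open>The added multiple cancels the coefficient of degree \<open>i\<close>, leaving
      only lower degrees.\<close>
    define r where "r = L + smult (a * real i) (Q i)"
    have "coeff r k = 0" if "i \<le> k" for k
    proof -
      have "coeff (Q i) (Suc k) = 0" using that by (intro coeff_eq_0) (simp add: degree_Q)
      moreover have "coeff (Q i) k = 0" if "k \<noteq> i" using that \<open>i \<le> k\<close> by (intro coeff_eq_0) (simp add: degree_Q)
      ultimately show ?thesis
        by (cases "k = i"; cases k) (auto simp: r_def L_def coeff_pCons coeff_pderiv algebra_simps split: nat.split)
    qed
    then have "gamma_mean a b (r * Q j) = 0" using that by (rule gamma_mean_mult_Q_eq_0)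
    \<comment> \<open>The bracket on the right is the total derivative expression for
      \<open>pderiv (Q i) * Q j\<close>, whose mean vanishes.\<close>
    moreover have "r * Q j + [:0, 1:] * (pderiv (Q i) * pderiv (Q j))
      = ([:b, -a:] * (pderiv (Q i) * Q j) + [:0, 1:] * pderiv (pderiv (Q i) * Q j)) + smult (a * real i) (Q i * Q j)"
      by (simp add: r_def L_def pderiv_mult algebra_simps)
    then have "gamma_mean a b (r * Q j) + gamma_mean a b ([:0, 1:] * (pderiv (Q i) * pderiv (Q j)))
       = a * real i * gamma_mean a b (Q i * Q j)"
      by (metis gamma_mean_add gamma_mean_smult gamma_mean_integration_by_parts add_0)
    ultimately show ?thesis by (simp add: gamma_mean_Q)
  qed
  show ?thesis
  proof (cases "i \<le> j")
    case False
    then show ?thesis using le[of j i] by (simp add: mult.commute[of "pderiv (Q i)"])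
  qed (rule le)
qed

end
end

section \<open>Weighted measures on the half-line and the series of squares\<close>

definition half_line_measure :: "(real \<Rightarrow> real) \<Rightarrow> real measure" where
  "half_line_measure w = density lborel (\<lambda>x. ennreal (indicator {0<..} x * w x))"

lemma sets_half_line_measure [measurable_cong]: "sets (half_line_measure w) = sets borel"
  by (simp add: half_line_measure_def)

lemma
  fixes g :: "real \<Rightarrow> real"
  assumes [measurable]: "w \<in> borel_measurable borel" "g \<in> borel_measurable borel"
    and w: "\<And>x. x > 0 \<Longrightarrow> 0 \<le> w x"
  shows integrable_half_line_measure:
      "integrable (half_line_measure w) g \<longleftrightarrow> integrable lborel (\<lambda>x. indicator {0<..} x * (g x * w x))"
    and integral_half_line_measure:
      "integral\<^sup>L (half_line_measure w) g = (\<integral>x. indicator {0<..} x * (g x * w x) \<partial>lborel)"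
proof -
  have 1: "AE x in lborel. 0 \<le> indicator {0<..} x * w x" using w by (auto simp: indicator_def)
  have 2: "(indicator {0<..} x * w x) *\<^sub>R g x = indicator {0<..} x * (g x * w x)" for x by (simp add: mult_ac)
  show "integrable (half_line_measure w) g \<longleftrightarrow> integrable lborel (\<lambda>x. indicator {0<..} x * (g x * w x))"
    unfolding half_line_measure_def using 1 by (subst integrable_density) (simp_all only: 2, measurable)
  show "integral\<^sup>L (half_line_measure w) g = (\<integral>x. indicator {0<..} x * (g x * w x) \<partial>lborel)"
    unfolding half_line_measure_def using 1 by (subst integral_density) (simp_all only: 2, measurable)
qed

lemma AE_half_line_measure:
  assumes [measurable]: "w \<in> borel_measurable borel" and "\<And>x. x > 0 \<Longrightarrow> P x"
  shows "AE x in half_line_measure w. P x"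
  unfolding half_line_measure_def
  by (subst AE_density) (use assms in \<open>auto simp: indicator_def\<close>)

text \<open>In the second system the index starts at \<open>Suc n\<close> because the derivative of
  \<open>Q 0\<close> is zero; the divisor is the norm of the derivative for the weight
  \<open>x * gamma_dens a b x\<close>.\<close>

lemma orthonormal_system_polys:
  assumes "a > 0" "b > 0" and Q: "orthonormal_polys (gamma_dens a b) Q"
  shows "orthonormal_system (half_line_measure (gamma_dens a b)) (\<lambda>n. poly (Q n))" (is ?A)
    and "orthonormal_system (half_line_measure (\<lambda>x. x * gamma_dens a b x))
       (\<lambda>n x. poly (pderiv (Q (Suc n))) x / sqrt (a * real (Suc n)))" (is ?B)
proof -
  note nn = gamma_dens_nonneg[OF assms(2)]
  show ?A
  proof
    fix i j
    have "poly (Q i) x * poly (Q j) x * gamma_dens a b x = poly (Q i * Q j) x * gamma_dens a b x" for x by simp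
    then show "integrable (half_line_measure (gamma_dens a b)) (\<lambda>x. poly (Q i) x * poly (Q j) x)"
       and "(\<integral>x. poly (Q i) x * poly (Q j) x \<partial>half_line_measure (gamma_dens a b)) = (if i = j then 1 else 0)"
      using integrable_poly_gamma_dens[OF assms(1,2), of "Q i * Q j"] gamma_mean_Q[OF assms, of i j] nn
      by (simp_all only: integrable_half_line_measure integral_half_line_measure gamma_mean_def
           borel_measurable_gamma_dens borel_measurable_times borel_measurable_poly)
  next
    show "poly (Q n) \<in> borel_measurable (half_line_measure (gamma_dens a b))" for n by measurable
  qed
  let ?d = "\<lambda>n. pderiv (Q (Suc n))"
  have nn': "0 \<le> x * gamma_dens a b x" if "x > 0" for x using nn that by simp
  have m[measurable]: "(\<lambda>x. x * gamma_dens a b x) \<in> borel_measurable borel" by measurable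
  show ?B
  proof
    fix i j
    define c where "c = sqrt (a * real (Suc i)) * sqrt (a * real (Suc j))"
    have eq: "indicator {0<..} x * (poly (?d i) x / sqrt (a * real (Suc i)) * (poly (?d j) x / sqrt (a * real (Suc j))) * (x * gamma_dens a b x))
      = (1 / c) * (indicator {0<..} x * (poly ([:0, 1:] * (?d i * ?d j)) x * gamma_dens a b x))" for x :: real
      by (simp add: c_def mult_ac)
    have "c = a * real (Suc i)" if "i = j" using that assms(1) by (simp add: c_def)
    then have c: "1 / c * (if i = j then a * real (Suc i) else 0) = (if i = j then 1 else 0)"
      using assms(1) by simp
    have mm: "(\<lambda>x. poly (?d i) x / sqrt (a * real (Suc i)) * (poly (?d j) x / sqrt (a * real (Suc j)))) \<in> borel_measurable borel"
      by measurable
    show "integrable (half_line_measure (\<lambda>x. x * gamma_dens a b x))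
        (\<lambda>x. poly (?d i) x / sqrt (a * real (Suc i)) * (poly (?d j) x / sqrt (a * real (Suc j))))"
    proof (rule iffD2[OF integrable_half_line_measure[OF m mm nn']])
      show "integrable lborel (\<lambda>x. indicator {0<..} x * (poly (?d i) x / sqrt (a * real (Suc i)) *
          (poly (?d j) x / sqrt (a * real (Suc j))) * (x * gamma_dens a b x)))"
        unfolding eq by (intro integrable_mult_right integrable_poly_gamma_dens assms)
    qed
    have "(\<integral>x. poly (?d i) x / sqrt (a * real (Suc i)) * (poly (?d j) x / sqrt (a * real (Suc j)))
        \<partial>half_line_measure (\<lambda>x. x * gamma_dens a b x))
      = (\<integral>x. indicator {0<..} x * (poly (?d i) x / sqrt (a * real (Suc i)) *
          (poly (?d j) x / sqrt (a * real (Suc j))) * (x * gamma_dens a b x)) \<partial>lborel)"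
      by (rule integral_half_line_measure[OF m mm nn'])
    also have "\<dots> = 1 / c * gamma_mean a b ([:0, 1:] * (?d i * ?d j))"
      unfolding eq gamma_mean_def by (rule integral_mult_right_zero)
    also have "\<dots> = (if i = j then 1 else 0)"
      using gamma_mean_pderiv_Q[OF assms, of "Suc i" "Suc j"] c by (simp only: nat.inject)
    finally show "(\<integral>x. poly (?d i) x / sqrt (a * real (Suc i)) * (poly (?d j) x / sqrt (a * real (Suc j)))
        \<partial>half_line_measure (\<lambda>x. x * gamma_dens a b x)) = (if i = j then 1 else 0)" .
  next
    show "(\<lambda>x. poly (?d n) x / sqrt (a * real (Suc n))) \<in> borel_measurable (half_line_measure (\<lambda>x. x * gamma_dens a b x))" for n
      by measurable
  qed
qed

text \<open>Twice Bessel's inequality, for \<open>Q\<close> and for the derivatives of \<open>Q\<close>, applied to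
  \<open>(x - c) Q\<^sub>n(x) = \<integral>\<^sub>c\<^sup>x Q\<^sub>n(z) dz + \<integral>\<^sub>c\<^sup>x (z - c) Q\<^sub>n'(z) dz\<close>.\<close>
lemma summable_orthonormal_polys_square_div:
  assumes a: "a > 0" and b: "b > 0" and Q: "orthonormal_polys (gamma_dens a b) Q" and x: "x > 0"
  shows "summable (\<lambda>n. (poly (Q (Suc n)) x)\<^sup>2 / real (Suc n))"
proof -
  \<comment> \<open>The midpoint keeps \<open>[c, x]\<close> inside the open half-line, away from
    the origin, where the reciprocal of the weight \<open>?w'\<close> blows up.\<close>
  define c where "c = x / 2"
  have c: "0 < c" "c < x" using x by (auto simp: c_def)
  let ?w = "gamma_dens a b" and ?w' = "\<lambda>x. x * gamma_dens a b x"
  note wpos = gamma_dens_pos[OF a b]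
  interpret A: orthonormal_system "half_line_measure ?w" "\<lambda>n. poly (Q n)"
    using a b Q by (rule orthonormal_system_polys)
  interpret B: orthonormal_system "half_line_measure ?w'"
      "\<lambda>n x. poly (pderiv (Q (Suc n))) x / sqrt (a * real (Suc n))"
    using a b Q by (rule orthonormal_system_polys)
  have cw: "isCont ?w z" if "c \<le> z" for z
    using that c unfolding gamma_dens_def by (intro continuous_intros) auto
  \<comment> \<open>Dividing by the weights makes the Fourier coefficients of \<open>g\<close> and
    \<open>g'\<close> equal to unweighted integrals over \<open>[c, x]\<close>, the second with the
    factor \<open>z - c\<close>.\<close>
  define g where "g z = indicator {c..x} z * (1 / ?w z)" for z
  define g' where "g' z = indicator {c..x} z * ((z - c) / ?w' z)" for z
  have [measurable]: "g \<in> borel_measurable borel" "g' \<in> borel_measurable borel" "?w' \<in> borel_measurable borel"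
    unfolding g_def[abs_def] g'_def[abs_def] by measurable
  have nn: "0 \<le> ?w z" "0 \<le> ?w' z" if "z > 0" for z using wpos[OF that] that by auto
  have gi: "integrable (half_line_measure ?w) (\<lambda>z. (g z)\<^sup>2)"
  proof -
    have "integrable lborel (\<lambda>z. 1 / ?w z * indicator {c..x} z)"
      using c wpos cw by (intro borel_integrable_atLeastAtMost continuous_intros) (auto simp: less_imp_neq[symmetric])
    also have "(\<lambda>z. 1 / ?w z * indicator {c..x} z) = (\<lambda>z. indicator {0<..} z * ((g z)\<^sup>2 * ?w z))"
      using c wpos by (auto simp: g_def indicator_def power2_eq_square fun_eq_iff less_imp_neq[symmetric])
    finally show ?thesis using nn by (subst integrable_half_line_measure) auto
  qed
  have gi': "integrable (half_line_measure ?w') (\<lambda>z. (g' z)\<^sup>2)"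
  proof -
    have "integrable lborel (\<lambda>z. (z - c)\<^sup>2 / ?w' z * indicator {c..x} z)"
    proof (intro borel_integrable_atLeastAtMost continuous_intros)
      fix z assume z: "c \<le> z" "z \<le> x"
      show "isCont ?w z" by (rule cw) fact
      show "z * ?w z \<noteq> 0" using wpos[of z] z c by simp
    qed
    also have "(\<lambda>z. (z - c)\<^sup>2 / ?w' z * indicator {c..x} z) = (\<lambda>z. indicator {0<..} z * ((g' z)\<^sup>2 * ?w' z))"
    proof
      fix z show "(z - c)\<^sup>2 / ?w' z * indicator {c..x} z = indicator {0<..} z * ((g' z)\<^sup>2 * ?w' z)"
        using c wpos[of z] by (cases "z \<in> {c..x}") (auto simp: g'_def power2_eq_square)
    qed
    finally show ?thesis using nn by (subst integrable_half_line_measure) auto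
  qed
  define u where "u n = (\<integral>z. g z * poly (Q n) z \<partial>half_line_measure ?w)" for n
  define v where "v n = (\<integral>z. g' z * (poly (pderiv (Q (Suc n))) z / sqrt (a * real (Suc n))) \<partial>half_line_measure ?w')" for n
  have su: "summable (\<lambda>n. (u (Suc n))\<^sup>2)"
    unfolding u_def by (subst summable_Suc_iff, rule A.Bessel[OF _ gi]) measurable
  have sv: "summable (\<lambda>n. (v n)\<^sup>2)"
    unfolding v_def by (rule B.Bessel[OF _ gi']) measurable
  have u: "u n = (\<integral>z. poly (Q n) z * indicator {c..x} z \<partial>lborel)" for n
  proof -
    have "indicator {0<..} z * (g z * poly (Q n) z * ?w z) = poly (Q n) z * indicator {c..x} z" for z
      using c wpos[of z] by (cases "z \<in> {c..x}") (auto simp: g_def)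
    moreover have "u n = (\<integral>z. indicator {0<..} z * (g z * poly (Q n) z * ?w z) \<partial>lborel)"
      unfolding u_def using nn by (intro integral_half_line_measure) auto
    ultimately show ?thesis by (simp only:)
  qed
  have v: "sqrt (a * real (Suc n)) * v n = (\<integral>z. poly ([:-c, 1:] * pderiv (Q (Suc n))) z * indicator {c..x} z \<partial>lborel)" for n
  proof -
    have "sqrt (a * real (Suc n)) * (indicator {0<..} z * (g' z * (poly (pderiv (Q (Suc n))) z / sqrt (a * real (Suc n))) * ?w' z))
        = poly ([:-c, 1:] * pderiv (Q (Suc n))) z * indicator {c..x} z" for z
      using c wpos[of z] a by (cases "z \<in> {c..x}") (auto simp: g'_def simp flip: left_diff_distrib)
    moreover have "v n = (\<integral>z. indicator {0<..} z *
        (g' z * (poly (pderiv (Q (Suc n))) z / sqrt (a * real (Suc n))) * ?w' z) \<partial>lborel)"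
      unfolding v_def using nn by (intro integral_half_line_measure) auto
    ultimately show ?thesis by (simp only: flip: integral_mult_right_zero)
  qed
  \<comment> \<open>The factor \<open>z - c\<close> removes the boundary value at \<open>c\<close>.
    The square root restores the normalisation of the derivative, and its growth is what the
    division by \<open>n + 1\<close> in the series absorbs.\<close>
  have eq: "(x - c) * poly (Q (Suc n)) x = u (Suc n) + sqrt (a * real (Suc n)) * v n" for n
  proof -
    have pi: "integrable lborel (\<lambda>z. poly p z * indicator {c..x} z)" for p
      by (intro borel_integrable_atLeastAtMost continuous_intros)
    have "(\<integral>z. poly (pderiv ([:-c, 1:] * Q (Suc n))) z * indicator {c..x} z \<partial>lborel)
       = poly ([:-c, 1:] * Q (Suc n)) x - poly ([:-c, 1:] * Q (Suc n)) c"
      using c by (intro integral_FTC_Icc_real poly_DERIV continuous_intros) auto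
    also have "\<dots> = (x - c) * poly (Q (Suc n)) x" by (simp add: algebra_simps)
    also have "(\<integral>z. poly (pderiv ([:-c, 1:] * Q (Suc n))) z * indicator {c..x} z \<partial>lborel)
      = (\<integral>z. poly (Q (Suc n)) z * indicator {c..x} z + poly ([:-c, 1:] * pderiv (Q (Suc n))) z * indicator {c..x} z \<partial>lborel)"
      by (simp only: pderiv_mult) (simp add: pderiv_pCons algebra_simps)
    also have "\<dots> = u (Suc n) + sqrt (a * real (Suc n)) * v n"
      unfolding u v by (intro Bochner_Integration.integral_add pi)
    finally show ?thesis by simp
  qed
  show ?thesis
  proof (rule summable_comparison_test')
    show "summable (\<lambda>n. 2 / (x - c)\<^sup>2 * ((u (Suc n))\<^sup>2 + a * (v n)\<^sup>2))"
      by (intro summable_mult summable_add su sv)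
    fix n
    let ?N = "real (Suc n)"
    have "(x - c)\<^sup>2 * (poly (Q (Suc n)) x)\<^sup>2 = (u (Suc n) + sqrt (a * ?N) * v n)\<^sup>2"
      by (simp only: eq[symmetric] power_mult_distrib)
    also have "\<dots> \<le> 2 * ((u (Suc n))\<^sup>2 + (sqrt (a * ?N) * v n)\<^sup>2)"
      using sum_squares_bound[of "u (Suc n)" "sqrt (a * ?N) * v n"] by (simp add: power2_sum)
    also have "\<dots> = 2 * ((u (Suc n))\<^sup>2 + ?N * (a * (v n)\<^sup>2))"
      using a by (simp add: power_mult_distrib mult_ac)
    also have "\<dots> \<le> 2 * (?N * (u (Suc n))\<^sup>2 + ?N * (a * (v n)\<^sup>2))"
      by (intro mult_left_mono add_right_mono) (auto simp: mult_le_cancel_right1)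
    finally have "(x - c)\<^sup>2 * (poly (Q (Suc n)) x)\<^sup>2 \<le> ?N * (2 * ((u (Suc n))\<^sup>2 + a * (v n)\<^sup>2))"
      by (simp only: distrib_left mult_ac)
    then have "(poly (Q (Suc n)) x)\<^sup>2 / ?N \<le> 2 / (x - c)\<^sup>2 * ((u (Suc n))\<^sup>2 + a * (v n)\<^sup>2)"
      using c by (simp add: field_simps del: of_nat_Suc)
    then show "norm ((poly (Q (Suc n)) x)\<^sup>2 / ?N) \<le> 2 / (x - c)\<^sup>2 * ((u (Suc n))\<^sup>2 + a * (v n)\<^sup>2)"
      by (simp del: of_nat_Suc)
  qed
qed

section \<open>Convergence to the stationary density\<close>

lemma has_bochner_integral_distributed_half_line:
  fixes f :: "real \<Rightarrow> real"
  assumes "prob_space M" and D: "distributed M lborel Y (\<lambda>x. ennreal (indicator {0<..} x * f x))"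
    and f: "\<And>x. x > 0 \<Longrightarrow> 0 \<le> f x"
  shows "has_bochner_integral lborel (\<lambda>x. indicator {0<..} x * f x) 1"
proof -
  interpret prob_space M by fact
  have nn: "0 \<le> indicator {0<..} x * f x" for x using f[of x] by (auto simp: indicator_def)
  \<comment> \<open>Measurability of the real-valued density is recovered from that of its extended
    version, the two agreeing by nonnegativity.\<close>
  have "(\<lambda>x. enn2real (ennreal (indicator {0<..} x * f x))) \<in> borel_measurable lborel"
    using distributed_borel_measurable[OF D] by measurable
  then have m: "(\<lambda>x. indicator {0<..} x * f x) \<in> borel_measurable lborel" using nn by simp
  have "(\<integral>\<^sup>+x. ennreal (indicator {0<..} x * f x) \<partial>lborel) = emeasure (density lborel (\<lambda>x. ennreal (indicator {0<..} x * f x))) UNIV"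
    using distributed_borel_measurable[OF D] by (subst emeasure_density) auto
  also have "\<dots> = emeasure (distr M lborel Y) UNIV"
    using distributed_distr_eq_density[OF D] by simp
  also have "\<dots> = 1"
    using distributed_measurable[OF D] by (subst emeasure_distr) (auto simp: emeasure_space_1)
  finally show ?thesis using m nn by (intro has_bochner_integral_nn_integral) auto
qed

theorem theorem6p5:
  fixes M :: "'w measure"
    and \<alpha> \<gamma> \<theta> a b x :: real
    and Q :: "nat \<Rightarrow> real poly"
    and f :: "real \<Rightarrow> real"
    and X S Y :: "real \<Rightarrow> 'w \<Rightarrow> real"
  assumes "0 < \<alpha>" and "\<alpha> < 1" and "\<gamma> \<ge> 0" and "0 < \<alpha> + \<gamma>" and "\<alpha> + \<gamma> \<le> 1"
    and "\<theta> > 0" and "a > 0" and "b > 0"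
    and "orthonormal_polys (gamma_dens a b) Q"
    and "stretched_cir_process M \<alpha> \<gamma> \<theta> a b Q f X S Y"
    and "set_integrable lborel {0<..} (\<lambda>y. (f y / gamma_dens a b y)\<^sup>2 * gamma_dens a b y)"
    and "\<And>c d. 0 < c \<Longrightarrow> c \<le> d \<Longrightarrow>
           uniform_limit {c..d}
             (\<lambda>N y. \<Sum>n<N. (LBINT z:{0<..}. f z * poly (Q n) z) * poly (Q n) y)
             (\<lambda>y. f y / gamma_dens a b y) sequentially"
    and "x > 0"
  shows "((\<lambda>t. stretched_cir_density \<alpha> \<gamma> \<theta> a b Q f t x)
            \<longlongrightarrow> a powr b / Gamma b * x powr (b - 1) * exp (- a * x)) at_top"
proof -
  note al = assms(1-3) and th = assms(6) and a = assms(7) and b = assms(8) and Q = assms(9) and x = assms(13)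
  let ?w = "gamma_dens a b" and ?N = "half_line_measure (gamma_dens a b)"
  define \<beta> where "\<beta> = \<alpha> + \<gamma>"
  define KS where "KS = kilbas_saigo \<alpha> (1 + \<gamma>/\<alpha>) (\<gamma>/\<alpha>)"
  define E where "E t n = KS (- cir_eigenvalue \<theta> n * t powr \<beta>)" for t n
  \<comment> \<open>Shifted index: the stationary term \<open>n = 0\<close> is split off, and
    division by \<open>n + 1\<close> is harmless.\<close>
  define q where "q y n = poly (Q (Suc n)) y" for y n
  note wpos = gamma_dens_pos[OF a b]
  have nn: "0 \<le> ?w y" if "y > 0" for y using wpos[OF that] by simp
  interpret orthonormal_system ?N "\<lambda>n. poly (Q n)"
    using a b Q by (rule orthonormal_system_polys)
  have sq: "summable (\<lambda>n. (q y n)\<^sup>2 / real (Suc n))" if "y > 0" for y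
    unfolding q_def using a b Q that by (rule summable_orthonormal_polys_square_div)
  have amgm: "\<bar>r * s\<bar> \<le> r\<^sup>2 + s\<^sup>2" for r s :: real
    using sum_squares_bound[of "\<bar>r\<bar>" "\<bar>s\<bar>"] abs_ge_zero[of "r * s"] unfolding power2_abs abs_mult by linarith

  \<comment> \<open>Fourier coefficients of the initial density\<close>
  have F: "has_bochner_integral lborel (\<lambda>y. indicator {0<..} y * f y) 1"
    using assms(10) unfolding stretched_cir_process_def by (intro has_bochner_integral_distributed_half_line) auto
  then have [measurable]: "(\<lambda>y. indicator {0<..} y * f y) \<in> borel_measurable borel"
    by (auto simp: has_bochner_integral_iff)
  define g where "g y = indicator {0<..} y * f y / ?w y" for y
  have [measurable]: "g \<in> borel_measurable borel" unfolding g_def[abs_def] by measurable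
  have gw: "indicator {0<..} y * (g y * k * ?w y) = indicator {0<..} y * (k * f y)" for y k
    using wpos[of y] by (cases "0 < y") (auto simp: g_def)
  have g2: "integrable ?N (\<lambda>y. (g y)\<^sup>2)"
  proof -
    have "integrable lborel (\<lambda>y. indicator {0<..} y * ((f y / ?w y)\<^sup>2 * ?w y))"
      using assms(11) by (simp add: set_integrable_def)
    also have "(\<lambda>y. indicator {0<..} y * ((f y / ?w y)\<^sup>2 * ?w y)) = (\<lambda>y. indicator {0<..} y * ((g y)\<^sup>2 * ?w y))"
      by (auto simp: g_def indicator_def)
    finally show ?thesis using nn by (subst integrable_half_line_measure) auto
  qed
  have gN: "g \<in> borel_measurable ?N" by measurable
  \<comment> \<open>Since \<open>g\<close> times the weight is \<open>f\<close> on the half-line,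
    these are the coefficients \<open>a_n\<close> of the initial density.\<close>
  define A where "A n = (\<integral>y. g y * poly (Q n) y \<partial>?N)" for n
  have sA: "summable (\<lambda>n. (A n)\<^sup>2)" unfolding A_def by (rule Bessel[OF gN g2])

  \<comment> \<open>The constant polynomial is 1 or -1. Its sign is left open, since only
    \<open>c * c = 1\<close> enters the final value.\<close>
  obtain c where c: "Q 0 = [:c:]" using degree_Q[OF a b Q, of 0] by (rule degree_eq_zeroE)
  have "gamma_mean a b [:c * c:] = 1" using gamma_mean_Q[OF a b Q, of 0 0] c by simp
  then have cc: "c * c = 1" using gamma_mean_monom[OF a b, of "c * c" 0] by (simp add: monom_0)
  have A0: "A 0 = c"
  proof -
    have "A 0 = (\<integral>y. indicator {0<..} y * (g y * poly (Q 0) y * ?w y) \<partial>lborel)"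
      unfolding A_def using nn by (intro integral_half_line_measure) auto
    also have "\<dots> = c * (\<integral>y. indicator {0<..} y * f y \<partial>lborel)"
      unfolding gw c by (simp flip: integral_mult_right_zero add: mult_ac)
    finally show ?thesis using has_bochner_integral_integral_eq[OF F] by simp
  qed

  \<comment> \<open>Decay of the spectral factors\<close>
  define C where "C = (\<gamma> + 1) / ((1 - \<alpha>) * Gamma (1 - \<alpha>)) / \<theta>"
  have C0: "0 \<le> C" using al th by (auto simp: C_def intro!: divide_nonneg_nonneg mult_nonneg_nonneg less_imp_le[OF Gamma_real_pos])
  have E0: "E t 0 = 1" for t by (simp add: E_def KS_def cir_eigenvalue_def kilbas_saigo_0)
  \<comment> \<open>The decay rate \<open>1 / w\<close> at
    \<open>w = \<theta> * (n + 1) * t powr \<beta>\<close> yields both a factor vanishing in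
    \<open>t\<close> and a factor \<open>1 / (n + 1)\<close>, which makes the squares of
    \<open>q x n\<close> summable. The division by \<open>\<theta>\<close> is already in
    \<open>C\<close>.\<close>
  have Eb: "\<bar>E t (Suc n)\<bar> \<le> C / t powr \<beta> / real (Suc n)" if "t > 0" for t n
  proof -
    define z where "z = cir_eigenvalue \<theta> (Suc n) * t powr \<beta>"
    have z: "z > 0" using th that by (simp add: z_def cir_eigenvalue_def)
    have "E t (Suc n) = KS (- z)" by (simp add: E_def z_def)
    moreover have "0 \<le> KS (- z)" unfolding KS_def by (rule kilbas_saigo_nonneg) (use al z in auto)
    moreover have "KS (- z) \<le> (\<gamma> + 1) / ((1 - \<alpha>) * Gamma (1 - \<alpha>)) / z"
      unfolding KS_def by (rule kilbas_saigo_decay) (use al z in auto)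
    moreover have "(\<gamma> + 1) / ((1 - \<alpha>) * Gamma (1 - \<alpha>)) / z = C / t powr \<beta> / real (Suc n)"
      by (simp add: C_def z_def cir_eigenvalue_def mult_ac)
    ultimately show ?thesis by simp
  qed

  \<comment> \<open>Expansion of the density and passage to the limit\<close>
  define B where "B = (\<Sum>n. (q x n)\<^sup>2 / real (Suc n) + (A (Suc n))\<^sup>2)"
  \<comment> \<open>The majorant does not involve \<open>t\<close>; all dependence on time will sit
    in the prefactor \<open>C / t powr \<beta>\<close>.\<close>
  have sB: "summable (\<lambda>n. (q x n)\<^sup>2 / real (Suc n) + (A (Suc n))\<^sup>2)"
    using sA by (intro summable_add sq x) (simp only: summable_Suc_iff[of "\<lambda>n. (A n)\<^sup>2"])
  have dens: "\<bar>stretched_cir_density \<alpha> \<gamma> \<theta> a b Q f t x - ?w x\<bar> \<le> ?w x * (C * B / t powr \<beta>)" if t: "t > 0" for t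
  proof -
    define Ct where "Ct = C / t powr \<beta>"
    have Ct0: "0 \<le> Ct" using C0 by (simp add: Ct_def)
    define k where "k n = E t n * poly (Q n) x" for n
    have kS: "k (Suc n) = E t (Suc n) * q x n" for n by (simp add: k_def q_def)
    have Eb': "\<bar>E t (Suc n)\<bar> \<le> Ct / real (Suc n)" for n using Eb[OF t] by (simp add: Ct_def)
    \<comment> \<open>Stated for arbitrary \<open>r\<close> because it serves twice: with
      \<open>r = q y n\<close> for convergence of the kernel at \<open>y\<close>, and with
      \<open>r = A (Suc n)\<close> for the remainder of the density.\<close>
    have prod: "\<bar>k (Suc n) * r\<bar> \<le> Ct * ((q x n)\<^sup>2 / real (Suc n) + r\<^sup>2 / real (Suc n))" for n r
    proof -
      have "\<bar>k (Suc n) * r\<bar> = \<bar>E t (Suc n)\<bar> * \<bar>q x n * r\<bar>" by (simp add: kS abs_mult)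
      also have "\<dots> \<le> Ct / real (Suc n) * ((q x n)\<^sup>2 + r\<^sup>2)"
        using Eb' amgm Ct0 by (intro mult_mono) auto
      finally show ?thesis by (simp add: field_simps del: of_nat_Suc)
    qed
    have "summable (\<lambda>n. (k (Suc n))\<^sup>2)"
    proof (rule summable_comparison_test'[OF summable_mult[OF sq[OF x], of "Ct\<^sup>2"]])
      fix n
      have "(k (Suc n))\<^sup>2 = \<bar>E t (Suc n)\<bar>\<^sup>2 * (q x n)\<^sup>2" by (simp add: kS power_mult_distrib)
      also have "\<dots> \<le> (Ct / real (Suc n))\<^sup>2 * (q x n)\<^sup>2"
        using Eb' by (intro mult_right_mono power_mono) auto
      also have "\<dots> = Ct\<^sup>2 * ((q x n)\<^sup>2 / real (Suc n)) / real (Suc n)"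
        by (simp add: power2_eq_square del: of_nat_Suc)
      also have "\<dots> \<le> Ct\<^sup>2 * ((q x n)\<^sup>2 / real (Suc n)) / 1"
        by (intro divide_left_mono) auto
      finally show "norm ((k (Suc n))\<^sup>2) \<le> Ct\<^sup>2 * ((q x n)\<^sup>2 / real (Suc n))" by simp
    qed
    then have k2: "summable (\<lambda>n. (k n)\<^sup>2)" by (simp only: summable_Suc_iff[of "\<lambda>n. (k n)\<^sup>2"])
    have pw: "summable (\<lambda>n. k n * poly (Q n) y)" if "y > 0" for y
    proof -
      have "summable (\<lambda>n. k (Suc n) * q y n)"
      proof (rule summable_comparison_test')
        show "summable (\<lambda>n. Ct * ((q x n)\<^sup>2 / real (Suc n) + (q y n)\<^sup>2 / real (Suc n)))"
          by (intro summable_mult summable_add sq x that)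
        show "norm (k (Suc n) * q y n) \<le> Ct * ((q x n)\<^sup>2 / real (Suc n) + (q y n)\<^sup>2 / real (Suc n))" for n
          using prod by simp
      qed
      then show ?thesis unfolding q_def by (simp only: summable_Suc_iff[of "\<lambda>n. k n * poly (Q n) y"])
    qed
    define K where "K y = (\<Sum>n. k n * poly (Q n) y)" for y
    have [measurable]: "K \<in> borel_measurable borel" unfolding K_def[abs_def] by measurable
    \<comment> \<open>The exchange of sum and integral: the transition kernel is a series in
      \<open>y\<close> with square-summable coefficients that converges at every positive
      \<open>y\<close>.\<close>
    have kA: "(\<lambda>n. k n * A n) sums (\<integral>y. g y * K y \<partial>?N)"
      unfolding A_def K_def using pw
      by (intro integral_mult_suminf[OF gN g2 k2] AE_half_line_measure) auto
    have "stretched_cir_density \<alpha> \<gamma> \<theta> a b Q f t x = (\<integral>y. ?w x * (indicator {0<..} y * (K y * f y)) \<partial>lborel)"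
      unfolding stretched_cir_density_def set_lebesgue_integral_def
      by (simp add: stretched_cir_transition_density_def K_def k_def E_def KS_def \<beta>_def mult_ac)
    also have "\<dots> = ?w x * (\<integral>y. indicator {0<..} y * (g y * K y * ?w y) \<partial>lborel)"
      unfolding gw by (rule integral_mult_right_zero)
    also have "(\<integral>y. indicator {0<..} y * (g y * K y * ?w y) \<partial>lborel) = (\<integral>y. g y * K y \<partial>?N)"
      using nn by (intro integral_half_line_measure[symmetric]) auto
    also have "\<dots> = (\<Sum>n. k n * A n)" using kA by (rule sums_unique)
    finally have p: "stretched_cir_density \<alpha> \<gamma> \<theta> a b Q f t x = ?w x * (\<Sum>n. k n * A n)" .
    \<comment> \<open>The two occurrences of the constant \<open>c\<close> multiply to 1, so the
      term \<open>n = 0\<close> contributes exactly the stationary density.\<close>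
    have k0: "k 0 * A 0 = 1" by (simp add: k_def E0 A0 c cc)
    have "(\<lambda>n. k (Suc n) * A (Suc n)) sums ((\<Sum>n. k n * A n) - 1)"
      using kA sums_unique[OF kA] k0 by (subst sums_Suc_iff) simp
    then have r: "(\<Sum>n. k n * A n) - 1 = (\<Sum>n. k (Suc n) * A (Suc n))" by (rule sums_unique)
    \<comment> \<open>For the coefficients of the initial density the factor
      \<open>1 / (n + 1)\<close> is discarded, as their squares are summable by Bessel's
      inequality.\<close>
    have rb: "norm (k (Suc n) * A (Suc n)) \<le> Ct * ((q x n)\<^sup>2 / real (Suc n) + (A (Suc n))\<^sup>2)" for n
    proof -
      have "(A (Suc n))\<^sup>2 / real (Suc n) \<le> (A (Suc n))\<^sup>2 / 1"
        by (intro divide_left_mono) auto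
      then have "Ct * ((q x n)\<^sup>2 / real (Suc n) + (A (Suc n))\<^sup>2 / real (Suc n)) \<le> Ct * ((q x n)\<^sup>2 / real (Suc n) + (A (Suc n))\<^sup>2)"
        using Ct0 by (intro mult_left_mono add_left_mono) auto
      with prod[of n "A (Suc n)"] show ?thesis unfolding real_norm_def by linarith
    qed
    have "norm (\<Sum>n. k (Suc n) * A (Suc n)) \<le> (\<Sum>n. Ct * ((q x n)\<^sup>2 / real (Suc n) + (A (Suc n))\<^sup>2))"
      by (rule norm_suminf_le[OF rb]) (intro summable_mult sB)
    also have "\<dots> = Ct * B" unfolding B_def by (rule suminf_mult[OF sB])
    finally have "\<bar>(\<Sum>n. k n * A n) - 1\<bar> \<le> Ct * B" using r by simp
    then have "?w x * \<bar>(\<Sum>n. k n * A n) - 1\<bar> \<le> ?w x * (Ct * B)"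
      using nn[OF x] by (rule mult_left_mono)
    moreover have "stretched_cir_density \<alpha> \<gamma> \<theta> a b Q f t x - ?w x = ?w x * ((\<Sum>n. k n * A n) - 1)"
      unfolding p by (simp add: right_diff_distrib)
    ultimately show ?thesis using nn[OF x] by (simp add: abs_mult Ct_def)
  qed
  have "((\<lambda>t. ?w x * (C * B) * t powr (-\<beta>)) \<longlongrightarrow> ?w x * (C * B) * 0) at_top"
    using assms(4) by (intro tendsto_mult tendsto_const tendsto_neg_powr filterlim_ident) (simp add: \<beta>_def)
  then have lim: "((\<lambda>t. ?w x * (C * B / t powr \<beta>)) \<longlongrightarrow> 0) at_top"
    by (simp add: powr_minus divide_inverse mult.assoc)
  have "\<forall>\<^sub>F t in at_top. norm (stretched_cir_density \<alpha> \<gamma> \<theta> a b Q f t x - ?w x) \<le> ?w x * (C * B / t powr \<beta>)"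
    using eventually_gt_at_top[of 0] by eventually_elim (use dens in simp)
  from Lim_null_comparison[OF this lim]
  have "((\<lambda>t. stretched_cir_density \<alpha> \<gamma> \<theta> a b Q f t x) \<longlongrightarrow> ?w x) at_top"
    by (simp add: Lim_null[symmetric])
  then show ?thesis by (simp only: gamma_dens_def)
qed

end
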